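(* Let $p$ be a prime, let $G$ be an abelian $p$-group and let $x\in G$ be an element of exponent $n$ such that $\langle x\rangle\cap G^1=\{0\}$. The following are equivalent: (1) $\langle x\rangle\in\mathcal{Q}(G)$; (2) $\langle x\rangle\in\mathcal{P}(G)$; (3) $U(x)$ has at most one non-trivial gap, and if a non-trivial gap occurs before the index $k\geq 0$ and $h(p^{k}x)=k+\ell$, then $G$ has no cyclic direct summands of exponent $e$ with $k+1\le e\le n+\ell-1$.
   Context: All groups are abelian; $p$ is a fixed prime. For an abelian $p$-group $G$: $\mathcal{Q}(G)$ is the set of subgroups $N\le G$ such that every homomorphism $N\to G$ extends to an endomorphism of $G$; $\mathcal{P}(G)$ is the set of subgroups $N\le G$ such that every monomorphism $N\to G$ extends to an endomorphism of $G$. $G^1=\bigcap_{n>0}p^nG$ is the first Ulm subgroup. The exponent of $x\in G$ is the integer $\exp(x)$ such that $x$ has order $p^{\exp(x)}$; a cyclic summand of exponent $e$ is one of order $p^e$. For $x\in G$, $h(x)$ denotes the (generalized, ordinal-valued) $p$-height of $x$ in $G$: $h(x)=\sigma$ if $x\in p^\sigma G\setminus p^{\sigma+1}G$, and $h(x)=\infty$ if $x$ lies in the divisible part of $G$. If $\exp(x)=n$, the Ulm sequence of $x$ is $U(x)=(h(x),h(px),\dots,h(p^{n-1}x),\infty,\infty,\dots)$. An Ulm sequence $U=(h_0,h_1,\dots,h_{n-1},\infty,\dots)$ has a gap before $k$ if $h_k>h_{k-1}+1$, where by convention $h_{-1}=-1$; the gap before $n$ is called trivial, and gaps before indices $k<n$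 are non-trivial. *)

theory Defs
  imports
    "HOL-Algebra.Elementary_Groups"
    "HOL-Algebra.Multiplicative_Group"
    "HOL-Computational_Algebra.Primes"
    "HOL-Library.Extended"
begin

section \<open>Ordinals for measuring heights\<close>

text \<open>
  The subgroups \<open>p\<^sup>\<sigma>G\<close> of a group with elements in \<open>'a\<close> strictly decrease until they become
  stationary, so they become stationary at an ordinal below \<open>|'a|\<^sup>+\<close>. The type below is
  the initial ordinal of an infinite cardinal greater than \<open>|'a|\<close> and therefore contains every
  ordinal that occurs as a height; see \<open>height_exists\<close>.
\<close>

typedef 'a ulm_ordinal = "UNIV :: ('a + nat) set set" ..

lemma ulm_ordinal_order:
  shows "(x, x) \<in> card_of (UNIV :: ('a + nat) set set)"
    and "(x, y) \<in> card_of (UNIV :: ('a + nat) set set) \<Longrightarrow> (y, z) \<in> card_of (UNIV :: ('a + nat) set set)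
      \<Longrightarrow> (x, z) \<in> card_of (UNIV :: ('a + nat) set set)"
    and "(x, y) \<in> card_of (UNIV :: ('a + nat) set set) \<Longrightarrow> (y, x) \<in> card_of (UNIV :: ('a + nat) set set)
      \<Longrightarrow> x = y"
    and "(x, y) \<in> card_of (UNIV :: ('a + nat) set set) \<or> (y, x) \<in> card_of (UNIV :: ('a + nat) set set)"
    and "wf (card_of (UNIV :: ('a + nat) set set) - Id)"
proof -
  have w: "well_order_on UNIV (card_of (UNIV :: ('a + nat) set set))"
    by (rule card_of_well_order_on)
  show r: "(x, x) \<in> card_of (UNIV :: ('a + nat) set set)" for x
    using w by (auto simp: order_on_defs refl_on_def)
  show "(x, y) \<in> card_of (UNIV :: ('a + nat) set set) \<Longrightarrow> (y, z) \<in> card_of (UNIV :: ('a + nat) set set)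
      \<Longrightarrow> (x, z) \<in> card_of (UNIV :: ('a + nat) set set)"
    using w by (auto simp: order_on_defs dest: transD)
  show "(x, y) \<in> card_of (UNIV :: ('a + nat) set set) \<Longrightarrow> (y, x) \<in> card_of (UNIV :: ('a + nat) set set)
      \<Longrightarrow> x = y"
    using w by (auto simp: order_on_defs dest: antisymD)
  show "(x, y) \<in> card_of (UNIV :: ('a + nat) set set) \<or> (y, x) \<in> card_of (UNIV :: ('a + nat) set set)"
    using w r by (cases "x = y") (auto simp: order_on_defs total_on_def)
  show "wf (card_of (UNIV :: ('a + nat) set set) - Id)"
    using w by (auto simp: order_on_defs)
qed

instantiation ulm_ordinal :: (type) wellorder
begin

definition less_eq_ulm_ordinal :: "'a ulm_ordinal \<Rightarrow> 'a ulm_ordinal \<Rightarrow> bool" where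
  "\<alpha> \<le> \<beta> \<longleftrightarrow> (Rep_ulm_ordinal \<alpha>, Rep_ulm_ordinal \<beta>) \<in> card_of UNIV"

definition less_ulm_ordinal :: "'a ulm_ordinal \<Rightarrow> 'a ulm_ordinal \<Rightarrow> bool" where
  "\<alpha> < \<beta> \<longleftrightarrow> \<alpha> \<le> \<beta> \<and> \<not> \<beta> \<le> \<alpha>" for \<alpha> \<beta> :: "'a ulm_ordinal"

instance
proof
  fix \<alpha> \<beta> \<gamma> :: "'a ulm_ordinal"
  show "\<alpha> < \<beta> \<longleftrightarrow> \<alpha> \<le> \<beta> \<and> \<not> \<beta> \<le> \<alpha>"
    by (rule less_ulm_ordinal_def)
  show "\<alpha> \<le> \<alpha>"
    by (simp add: less_eq_ulm_ordinal_def ulm_ordinal_order)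
  show "\<alpha> \<le> \<beta> \<Longrightarrow> \<beta> \<le> \<gamma> \<Longrightarrow> \<alpha> \<le> \<gamma>"
    unfolding less_eq_ulm_ordinal_def by (rule ulm_ordinal_order)
  show "\<alpha> \<le> \<beta> \<Longrightarrow> \<beta> \<le> \<alpha> \<Longrightarrow> \<alpha> = \<beta>"
    unfolding less_eq_ulm_ordinal_def
    by (metis Rep_ulm_ordinal_inject ulm_ordinal_order(3))
  show "\<alpha> \<le> \<beta> \<or> \<beta> \<le> \<alpha>"
    unfolding less_eq_ulm_ordinal_def by (rule ulm_ordinal_order)
next
  fix P :: "'a ulm_ordinal \<Rightarrow> bool" and \<alpha> :: "'a ulm_ordinal"
  assume step: "\<And>\<alpha>. (\<And>\<beta>. \<beta> < \<alpha> \<Longrightarrow> P \<beta>) \<Longrightarrow> P \<alpha>"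
  have "wf (inv_image (card_of (UNIV :: ('a + nat) set set) - Id) Rep_ulm_ordinal)"
    by (intro wf_inv_image ulm_ordinal_order)
  then show "P \<alpha>"
  proof (induction \<alpha>)
    case (less \<alpha>)
    show ?case
    proof (rule step)
      fix \<beta> assume "\<beta> < \<alpha>"
      then have "(\<beta>, \<alpha>) \<in> inv_image (card_of (UNIV :: ('a + nat) set set) - Id) Rep_ulm_ordinal"
        by (auto simp: less_ulm_ordinal_def less_eq_ulm_ordinal_def)
      then show "P \<beta>" by (rule less.IH)
    qed
  qed
qed

end

instance ulm_ordinal :: (type) no_top
proof
  fix \<alpha> :: "'a ulm_ordinal"
  have "infinite (UNIV :: ('a + nat) set set)"
    by (simp add: Finite_Set.finite_set)
  then have "\<exists>b \<in> Field (card_of (UNIV :: ('a + nat) set set)).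
      Rep_ulm_ordinal \<alpha> \<noteq> b \<and> (Rep_ulm_ordinal \<alpha>, b) \<in> card_of UNIV"
    by (intro infinite_Card_order_limit card_of_Card_order) (simp_all add: Field_card_of)
  then obtain b where "Rep_ulm_ordinal \<alpha> \<noteq> b" "(Rep_ulm_ordinal \<alpha>, b) \<in> card_of UNIV"
    by blast
  then have "\<alpha> \<noteq> Abs_ulm_ordinal b" "\<alpha> \<le> Abs_ulm_ordinal b"
    by (auto simp: less_eq_ulm_ordinal_def Abs_ulm_ordinal_inverse)
  then show "\<exists>\<beta>. \<alpha> < \<beta>"
    by (auto simp: order_less_le)
qed

definition osucc :: "'a ulm_ordinal \<Rightarrow> 'a ulm_ordinal" where
  "osucc \<alpha> = (LEAST \<beta>. \<alpha> < \<beta>)"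

fun ord_of_nat :: "nat \<Rightarrow> 'a ulm_ordinal" where
  "ord_of_nat 0 = (LEAST \<alpha>. True)"
| "ord_of_nat (Suc n) = osucc (ord_of_nat n)"

lemma less_osucc: "\<alpha> < osucc \<alpha>"
  unfolding osucc_def by (rule LeastI_ex) (rule gt_ex)

lemma osucc_le: "\<alpha> < \<beta> \<Longrightarrow> osucc \<alpha> \<le> \<beta>"
  unfolding osucc_def by (rule Least_le)


section \<open>Heights and Ulm sequences\<close>

text \<open>
  Groups are written multiplicatively, as everywhere in \<open>HOL-Algebra\<close>: the multiple \<open>mx\<close> is
  \<open>x [^] m\<close>.
\<close>

definition p_group :: "nat \<Rightarrow> ('a, 'b) monoid_scheme \<Rightarrow> bool" where
  "p_group p G \<longleftrightarrow> (\<forall>x \<in> carrier G. \<exists>k. group.ord G x = p ^ k)"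

definition multiples :: "('a, 'b) monoid_scheme \<Rightarrow> nat \<Rightarrow> 'a set \<Rightarrow> 'a set" where
  "multiples G m A = (\<lambda>y. y [^]\<^bsub>G\<^esub> m) ` A"

definition first_ulm_subgroup :: "nat \<Rightarrow> ('a, 'b) monoid_scheme \<Rightarrow> 'a set" where
  "first_ulm_subgroup p G = (\<Inter>n \<in> {0<..}. multiples G (p ^ n) (carrier G))"

text \<open>
  The usual recursion \<open>p\<^sup>0G = G\<close>, \<open>p\<^sup>\<sigma>\<^sup>+\<^sup>1G = p(p\<^sup>\<sigma>G)\<close>, and \<open>p\<^sup>\<sigma>G\<close> the intersection of the
  \<open>p\<^sup>\<tau>G\<close> with \<open>\<tau> < \<sigma>\<close> for limits \<open>\<sigma>\<close>, as the single equation
  \<open>p\<^sup>\<sigma>G = G \<inter> (\<Inter>\<tau><\<sigma>. p(p\<^sup>\<tau>G))\<close>; the usual clauses are derived below.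
\<close>

function ulm_power :: "nat \<Rightarrow> ('a, 'b) monoid_scheme \<Rightarrow> 'a ulm_ordinal \<Rightarrow> 'a set" where
  "ulm_power p G \<sigma> = carrier G \<inter> (\<Inter>\<tau> \<in> {..<\<sigma>}. multiples G p (ulm_power p G \<tau>))"
  by pat_completeness auto
termination
  by (relation "{((p, G, \<sigma>), (p', G', \<sigma>')). \<sigma> < \<sigma>'}")
    (auto intro!: wf_subset[OF wf_inv_image[OF wf, of "\<lambda>(p, G, \<sigma>). \<sigma>"]] simp: inv_image_def)

declare ulm_power.simps [simp del]

definition divisible_subgroup :: "('a, 'b) monoid_scheme \<Rightarrow> 'a set \<Rightarrow> bool" where
  "divisible_subgroup G D \<longleftrightarrow>
     subgroup D G \<and> (\<forall>m > 0. \<forall>d \<in> D. \<exists>c \<in> D. c [^]\<^bsub>G\<^esub> (m::nat) = d)"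

definition divisible_part :: "('a, 'b) monoid_scheme \<Rightarrow> 'a set" where
  "divisible_part G = \<Union>{D. divisible_subgroup G D}"

definition height ::
    "nat \<Rightarrow> ('a, 'b) monoid_scheme \<Rightarrow> 'a \<Rightarrow> 'a ulm_ordinal extended" where
  "height p G x =
     (if x \<in> divisible_part G then \<infinity>
      else Fin (THE \<sigma>. x \<in> ulm_power p G \<sigma> - ulm_power p G (osucc \<sigma>)))"

definition ulm_sequence ::
    "nat \<Rightarrow> ('a, 'b) monoid_scheme \<Rightarrow> 'a \<Rightarrow> nat \<Rightarrow> 'a ulm_ordinal extended" where
  "ulm_sequence p G x i = height p G (x [^]\<^bsub>G\<^esub> (p ^ i))"

text \<open>
  A gap before 0 means \<open>h\<^sub>0 > h\<^sub>-\<^sub>1 + 1 = 0\<close>, since \<open>h\<^sub>-\<^sub>1 = -1\<close>.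
\<close>

definition gap_before :: "(nat \<Rightarrow> 'a ulm_ordinal extended) \<Rightarrow> nat \<Rightarrow> bool" where
  "gap_before U k \<longleftrightarrow>
     (case k of 0 \<Rightarrow> Fin (ord_of_nat 0) < U 0
      | Suc j \<Rightarrow> map_extended osucc (U j) < U (Suc j))"


section \<open>Extending homomorphisms, and cyclic direct summands\<close>

definition Q_subgroups :: "('a, 'b) monoid_scheme \<Rightarrow> 'a set set" where
  "Q_subgroups G = {N. subgroup N G \<and>
     (\<forall>f \<in> hom (G\<lparr>carrier := N\<rparr>) G. \<exists>g \<in> hom G G. \<forall>y \<in> N. g y = f y)}"

definition P_subgroups :: "('a, 'b) monoid_scheme \<Rightarrow> 'a set set" where
  "P_subgroups G = {N. subgroup N G \<and>
     (\<forall>f \<in> mon (G\<lparr>carrier := N\<rparr>) G. \<exists>g \<in> hom G G. \<forall>y \<in> N. g y = f y)}"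

definition direct_summand :: "('a, 'b) monoid_scheme \<Rightarrow> 'a set \<Rightarrow> bool" where
  "direct_summand G H \<longleftrightarrow> subgroup H G \<and>
     (\<exists>K. subgroup K G \<and> H \<inter> K = {\<one>\<^bsub>G\<^esub>} \<and> H <#>\<^bsub>G\<^esub> K = carrier G)"

definition has_cyclic_summand :: "nat \<Rightarrow> ('a, 'b) monoid_scheme \<Rightarrow> nat \<Rightarrow> bool" where
  "has_cyclic_summand p G e \<longleftrightarrow>
     (\<exists>H. direct_summand G H \<and> cyclic_group (G\<lparr>carrier := H\<rparr>)
        \<and> order (G\<lparr>carrier := H\<rparr>) = p ^ e)"


section \<open>Basic facts confirming the definition of height\<close>

lemma osucc_le_iff: "osucc \<alpha> \<le> \<beta> \<longleftrightarrow> \<alpha> < \<beta>"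
  using less_osucc osucc_le order_less_le_trans by blast

lemma less_osucc_iff: "\<alpha> < osucc \<beta> \<longleftrightarrow> \<alpha> \<le> \<beta>"
  by (meson leD leI less_osucc order_le_less_trans osucc_le)

lemma ulm_power_subset: "ulm_power p G \<sigma> \<subseteq> carrier G"
  by (subst ulm_power.simps) blast

lemma ulm_power_antimono: "\<sigma> \<le> \<tau> \<Longrightarrow> ulm_power p G \<tau> \<subseteq> ulm_power p G \<sigma>"
  by (subst (1 2) ulm_power.simps) (auto dest: order_less_le_trans)

lemma ulm_power_0: "ulm_power p G (ord_of_nat 0) = carrier G"
  by (subst ulm_power.simps) (auto dest: not_less_Least)

lemma multiples_mono: "A \<subseteq> B \<Longrightarrow> multiples G m A \<subseteq> multiples G m B"
  unfolding multiples_def by (rule image_mono)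

lemma (in monoid) multiples_subset: "A \<subseteq> carrier G \<Longrightarrow> multiples G m A \<subseteq> carrier G"
  unfolding multiples_def by auto

lemma (in monoid) ulm_power_osucc:
  "ulm_power p G (osucc \<sigma>) = multiples G p (ulm_power p G \<sigma>)"
proof
  show "ulm_power p G (osucc \<sigma>) \<subseteq> multiples G p (ulm_power p G \<sigma>)"
    by (subst ulm_power.simps) (use less_osucc in auto)
  show "multiples G p (ulm_power p G \<sigma>) \<subseteq> ulm_power p G (osucc \<sigma>)"
    apply (subst (2) ulm_power.simps)
    using multiples_subset[OF ulm_power_subset]
      multiples_mono[OF ulm_power_antimono] by (auto simp: less_osucc_iff) blast+
qed

lemma (in monoid) ulm_power_eq:
  "ulm_power p G \<sigma> = carrier G \<inter> (\<Inter>\<tau> \<in> {..<\<sigma>}. ulm_power p G (osucc \<tau>))"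
  by (subst ulm_power.simps) (simp add: ulm_power_osucc)

lemma (in monoid) ulm_power_limit:
  assumes "\<sigma> \<noteq> ord_of_nat 0" and "\<And>\<tau>. \<tau> < \<sigma> \<Longrightarrow> osucc \<tau> < \<sigma>"
  shows "ulm_power p G \<sigma> = (\<Inter>\<tau> \<in> {..<\<sigma>}. ulm_power p G \<tau>)"
proof
  show "ulm_power p G \<sigma> \<subseteq> (\<Inter>\<tau> \<in> {..<\<sigma>}. ulm_power p G \<tau>)"
    using ulm_power_antimono[of _ \<sigma> p G] by (meson INT_greatest lessThan_iff less_imp_le)
  have "ord_of_nat 0 < \<sigma>"
    using assms(1) by (simp add: Least_le order_less_le)
  then show "(\<Inter>\<tau> \<in> {..<\<sigma>}. ulm_power p G \<tau>) \<subseteq> ulm_power p G \<sigma>"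
    using assms(2) ulm_power_0[of p G] by (subst (2) ulm_power_eq) blast
qed

lemma (in comm_group) subgroup_ulm_power: "subgroup (ulm_power p G \<sigma>) G"
proof (induction \<sigma> rule: less_induct)
  case (less \<sigma>)
  have closed: "subgroup (multiples G p A) G" if A: "subgroup A G" for A
  proof (rule subgroupI)
    note sub = subgroup.subset[OF A]
    show "multiples G p A \<subseteq> carrier G" using sub by (rule multiples_subset)
    show "multiples G p A \<noteq> {}" using subgroup.one_closed[OF A] by (auto simp: multiples_def)
    show "inv a \<in> multiples G p A" if "a \<in> multiples G p A" for a
      using that sub subgroup.m_inv_closed[OF A]
      by (auto simp: multiples_def nat_pow_inv[symmetric] subset_iff)
    show "a \<otimes> b \<in> multiples G p A" if "a \<in> multiples G p A" "b \<in> multiples G p A" for a b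
      using that sub subgroup.m_closed[OF A]
      by (auto simp: multiples_def nat_pow_distrib[symmetric] subset_iff)
  qed
  have "subgroup (\<Inter>(insert (carrier G) ((\<lambda>\<tau>. multiples G p (ulm_power p G \<tau>)) ` {..<\<sigma>}))) G"
    by (rule subgroups_Inter) (use less closed subgroup_self in auto)
  then show ?case
    by (subst ulm_power.simps) simp
qed

lemma ulm_power_stationary: "\<exists>\<sigma>. ulm_power p G (osucc \<sigma>) = ulm_power p G \<sigma>"
proof (rule ccontr)
  assume "\<not> ?thesis"
  then have "\<exists>x. x \<in> ulm_power p G \<sigma> - ulm_power p G (osucc \<sigma>)" for \<sigma>
    using ulm_power_antimono[OF less_imp_le[OF less_osucc], of p G \<sigma>] by blast
  then obtain f where f: "\<And>\<sigma>. f \<sigma> \<in> ulm_power p G \<sigma> - ulm_power p G (osucc \<sigma>)"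
    by metis
  have "f \<sigma> \<noteq> f \<tau>" if "\<sigma> < \<tau>" for \<sigma> \<tau>
    using f[of \<sigma>] f[of \<tau>] ulm_power_antimono[OF osucc_le[OF that], of p G] by auto
  then have "inj f"
    by (metis injI neqE)
  then have inj: "inj (Inl \<circ> f \<circ> Abs_ulm_ordinal :: ('a + nat) set \<Rightarrow> 'a + nat)"
    by (intro inj_compose) (auto intro!: injI simp: Abs_ulm_ordinal_inject)
  have "surj (inv_into UNIV (Inl \<circ> f \<circ> Abs_ulm_ordinal :: ('a + nat) set \<Rightarrow> 'a + nat))"
    using inj by (rule inj_imp_surj_inv)
  then show False
    using Cantors_theorem[of UNIV] by auto
qed

theorem (in comm_group) height_exists:
  assumes p: "Factorial_Ring.prime p" and G: "p_group p G"
    and x: "x \<in> carrier G" "x \<notin> divisible_part G"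
  shows "\<exists>!\<sigma>. x \<in> ulm_power p G \<sigma> - ulm_power p G (osucc \<sigma>)"
proof -
  obtain \<sigma> where \<sigma>: "ulm_power p G (osucc \<sigma>) = ulm_power p G \<sigma>"
    using ulm_power_stationary ..
  let ?D = "ulm_power p G \<sigma>"
  have D: "subgroup ?D G" by (rule subgroup_ulm_power)
  have pdiv: "\<exists>c \<in> ?D. c [^] (p ^ k) = d" if "d \<in> ?D" for d and k :: nat
    using that
  proof (induction k arbitrary: d)
    case 0
    moreover from 0 have "d \<in> carrier G" by (rule subsetD[OF ulm_power_subset])
    ultimately show ?case by (intro bexI[of _ d]) simp_all
  next
    case (Suc k)
    from Suc.prems have "d \<in> multiples G p ?D"
      unfolding ulm_power_osucc[symmetric] \<sigma> .
    then obtain c where c: "c \<in> ?D" "c [^] p = d"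
      unfolding multiples_def by blast
    from Suc.IH[OF c(1)] obtain b where b: "b \<in> ?D" "b [^] (p ^ k) = c" by blast
    moreover have "b \<in> carrier G" using b(1) by (rule subsetD[OF ulm_power_subset])
    ultimately have "b [^] (p ^ Suc k) = d"
      using c(2) nat_pow_pow[of b "p ^ k" p] by (simp add: mult.commute)
    then show ?case using b by blast
  qed
  have "divisible_subgroup G ?D"
    unfolding divisible_subgroup_def
  proof (intro conjI D allI impI ballI)
    fix m :: nat and d assume m: "m > 0" and d: "d \<in> ?D"
    have "m \<noteq> 0" "\<not> is_unit p" using m p by auto
    then obtain q where "m = p ^ multiplicity p m * q" and q: "\<not> p dvd q"
      by (rule multiplicity_decompose')
    then obtain k where m_eq: "m = p ^ k * q" by blast
    obtain c where c: "c \<in> ?D" "c [^] (p ^ k) = d" using pdiv d by blast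
    from c(1) have cG: "c \<in> carrier G" by (rule subsetD[OF ulm_power_subset])
    obtain j where j: "ord c = p ^ j" using G cG by (auto simp: p_group_def)
    have "coprime q (p ^ j)"
      using p q by (metis coprime_commute coprime_power_left_iff prime_imp_coprime)
    moreover have "q \<noteq> 0" using q by (metis dvd_0_right)
    ultimately obtain r s where rs: "q * r = p ^ j * s + 1"
      using bezout_nat[of q "p ^ j"] by (auto simp: coprime_iff_gcd_eq_1)
    have "c [^] (p ^ j) = \<one>" using pow_ord_eq_1[OF cG] j by simp
    then have "c [^] (p ^ j * s) = \<one>"
      using nat_pow_pow[OF cG, of "p ^ j" s] by simp
    then have "c [^] (q * r) = c"
      using cG unfolding rs by simp
    then have "c [^] (q * r * p ^ k) = d"
      using nat_pow_pow[OF cG, of "q * r" "p ^ k"] c(2) by simp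
    then have "(c [^] r) [^] m = d"
      using cG by (simp only: nat_pow_pow m_eq ac_simps)
    moreover have "c [^] r \<in> ?D"
      using c(1) D by (induction r) (auto intro: subgroup.one_closed subgroup.m_closed)
    ultimately show "\<exists>c \<in> ?D. c [^] m = d" by blast
  qed
  then have "x \<notin> ?D" using x(2) by (auto simp: divisible_part_def)
  then have ex: "\<exists>\<tau>. x \<notin> ulm_power p G \<tau>" by blast
  define \<tau> where "\<tau> = (LEAST \<tau>. x \<notin> ulm_power p G \<tau>)"
  have \<tau>: "x \<notin> ulm_power p G \<tau>" unfolding \<tau>_def using ex by (rule LeastI_ex)
  then obtain \<rho> where \<rho>: "\<rho> < \<tau>" "x \<notin> ulm_power p G (osucc \<rho>)"
    using x(1) ulm_power_eq[of p \<tau>] by auto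
  then have "x \<in> ulm_power p G \<rho>" unfolding \<tau>_def using not_less_Least by blast
  with \<rho> have ex1: "x \<in> ulm_power p G \<rho> - ulm_power p G (osucc \<rho>)" by blast
  have no: False
    if "\<alpha> < \<beta>" "x \<in> ulm_power p G \<alpha> - ulm_power p G (osucc \<alpha>)"
      "x \<in> ulm_power p G \<beta> - ulm_power p G (osucc \<beta>)" for \<alpha> \<beta>
    using that ulm_power_antimono[OF osucc_le[OF that(1)], of p G] by blast
  show ?thesis
  proof (rule ex1I)
    show "x \<in> ulm_power p G \<rho> - ulm_power p G (osucc \<rho>)" by (rule ex1)
  next
    fix \<alpha> assume "x \<in> ulm_power p G \<alpha> - ulm_power p G (osucc \<alpha>)"
    then show "\<alpha> = \<rho>"
      using no[of \<alpha> \<rho>] no[of \<rho> \<alpha>] ex1 by (cases \<alpha> \<rho> rule: linorder_cases) auto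
  qed
qed

end

theory Submission
  imports Defs
begin

text \<open>
  Groups are multiplicative, so the subgroup \<open>p\<^sup>mG\<close> of the informal text consists of the
  \<open>p\<^sup>m\<close>-th powers. As \<open>\<langle>x\<rangle>\<close> meets the first Ulm subgroup trivially, the nontrivial powers
  \<open>x [^] (p ^ i)\<close> have finite heights, and only these subgroups matter: the ordinals
  of the definition of height disappear once heights are identified with natural numbers.

  Two facts carry the proof. If \<open>a\<close> has order \<open>p\<^sup>m\<^sup>+\<^sup>1\<close> and the
  generator \<open>a [^] (p ^ m)\<close> of the socle of \<open>\<langle>a\<rangle>\<close> avoids a subgroup \<open>L\<close> that contains all
  \<open>p\<^sup>m\<^sup>+\<^sup>1\<close>-th powers, then Zorn's lemma gives a complement of \<open>\<langle>a\<rangle>\<close> that contains \<open>L\<close>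
  (\<open>complement_of_cyclic\<close>); so \<open>a\<close> can be sent to any element of order dividing \<open>p\<^sup>m\<^sup>+\<^sup>1\<close> by an
  endomorphism that kills \<open>L\<close> (\<open>endomorphism_from_cyclic\<close>). Moreover, if \<open>z\<close> has height \<open>m\<close>
  and \<open>z\<^sup>p\<close> has height greater than \<open>m + 1\<close>, then there is an element of order \<open>p\<close> and height
  \<open>m\<close>, hence a cyclic summand of exponent \<open>m + 1\<close> (\<open>cyclic_summand_of_gap\<close>).

  Suppose that monomorphisms from \<open>\<langle>x\<rangle>\<close> extend. Endomorphisms do not lower heights, so every \<open>y\<close>
  with the order of \<open>x\<close> has an Ulm sequence that dominates the one of \<open>x\<close>. If the height of
  \<open>x [^] (p ^ k)\<close> is \<open>k + l\<close> with \<open>l > 0\<close>, then a summand \<open>\<langle>c\<rangle>\<close> of a forbidden exponent \<open>e\<close>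
  contradicts this, with \<open>y = x \<otimes> c\<close> for \<open>e < n\<close> and \<open>y\<close> a power of \<open>c\<close> for
  \<open>e \<ge> n\<close> (\<open>no_cyclic_summand_of_P_subgroup\<close>). Two gaps are impossible because the second one
  itself produces a summand whose exponent is forbidden by it.

  Conversely, let the sequence have a single gap, before \<open>k\<close>, and let \<open>y [^] (p ^ n) = \<one>\<close>. The
  missing summands force \<open>y [^] (p ^ k)\<close> to have height at least \<open>k + l\<close>, again because a gap would
  create one of them (\<open>pow_mem_powers_of_no_summand\<close>). One writes \<open>x = b \<otimes> a [^] (p ^ l)\<close> and
  \<open>y = d \<otimes> c [^] (p ^ l)\<close>, where \<open>a\<close> and \<open>c\<close> are \<open>p\<^sup>k\<^sup>+\<^sup>l\<close>-th roots of
  \<open>x [^] (p ^ k)\<close> and \<open>y [^] (p ^ k)\<close>. Then \<open>a\<close> and \<open>b\<close> generate independent pure subgroups, and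
  some endomorphism sends \<open>a\<close> to \<open>c\<close> and \<open>b\<close> to \<open>d\<close>, hence \<open>x\<close> to \<open>y\<close>
  (\<open>endomorphism_of_one_gap\<close>). Without any gap \<open>\<langle>x\<rangle>\<close> is itself a direct summand.
\<close>

section \<open>Power subgroups and finite heights\<close>

context comm_group
begin

abbreviation powers :: "nat \<Rightarrow> nat \<Rightarrow> 'a set" where
  "powers p m \<equiv> multiples G (p ^ m) (carrier G)"

lemma mem_powers_iff: "z \<in> powers p m \<longleftrightarrow> (\<exists>w \<in> carrier G. z = w [^] (p ^ m))"
  by (auto simp: multiples_def)

lemma powersI: "w \<in> carrier G \<Longrightarrow> w [^] (p ^ m) \<in> powers p m"
  by (auto simp: mem_powers_iff)

text \<open>
  Below the first limit ordinal the transfinite recursion just repeats the formation of \<open>p\<close>-th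
  powers; this is why finite heights can be treated as natural numbers.
\<close>

lemma ulm_power_ord_of_nat: "ulm_power p G (ord_of_nat m) = powers p m"
proof (induction m)
  case 0
  then show ?case using ulm_power_0[of p G] by (auto simp: multiples_def)
next
  case (Suc m)
  have "multiples G p (powers p m) = powers p (Suc m)"
    unfolding multiples_def image_image
    by (rule image_cong) (simp_all add: nat_pow_pow mult.commute)
  then show ?case by (simp add: ulm_power_osucc Suc del: power_Suc)
qed

lemma subgroup_powers: "subgroup (powers p m) G"
  using subgroup_ulm_power[of p "ord_of_nat m"] by (simp only: ulm_power_ord_of_nat)

lemma powers_antimono:
  assumes "m \<le> m'"
  shows "powers p m' \<subseteq> powers p m"
proof
  fix z assume "z \<in> powers p m'"
  then obtain w where w: "w \<in> carrier G" "z = w [^] (p ^ m')" by (auto simp: mem_powers_iff)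
  have "(w [^] (p ^ (m' - m))) [^] (p ^ m) = z"
    using w assms by (simp add: nat_pow_pow flip: power_add)
  then show "z \<in> powers p m" using w powersI[of "w [^] (p ^ (m' - m))" p m] by simp
qed

lemma powers_pow:
  assumes "z \<in> powers p m"
  shows "z [^] (p ^ i) \<in> powers p (m + i)"
proof -
  obtain w where w: "w \<in> carrier G" "z = w [^] (p ^ m)" using assms by (auto simp: mem_powers_iff)
  then have "z [^] (p ^ i) = w [^] (p ^ (m + i))" by (simp add: nat_pow_pow power_add)
  then show ?thesis using w(1) powersI[of w p "m + i"] by simp
qed

lemma hom_powers:
  assumes "g \<in> hom G G" "z \<in> powers p m"
  shows "g z \<in> powers p m"
proof -
  obtain w where w: "w \<in> carrier G" "z = w [^] (p ^ m)" using assms by (auto simp: mem_powers_iff)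
  then have "g z = g w [^] (p ^ m)"
    using assms(1) by (simp add: hom_nat_pow is_group)
  moreover have "g w \<in> carrier G" using assms(1) w(1) by (auto simp: hom_def)
  ultimately show ?thesis using powersI by simp
qed

definition has_finite_height :: "nat \<Rightarrow> 'a \<Rightarrow> nat \<Rightarrow> bool" where
  "has_finite_height p z m \<longleftrightarrow> z \<in> powers p m \<and> z \<notin> powers p (Suc m)"

lemma finite_height_exists:
  assumes z: "z \<in> powers p m" "z \<notin> powers p m'"
  shows "\<exists>j. m \<le> j \<and> j < m' \<and> has_finite_height p z j"
proof -
  define j where "j = (LEAST j. z \<notin> powers p (Suc j))"
  obtain i where i: "m' = Suc i"
    using z subgroup.mem_carrier[OF subgroup_powers z(1)] by (cases m') (auto simp: multiples_def)
  have j: "z \<notin> powers p (Suc j)" unfolding j_def by (rule LeastI[of _ i]) (use z i in simp)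
  have "j \<le> i" unfolding j_def by (rule Least_le) (use z i in simp)
  moreover have "m \<le> j"
    using j z(1) powers_antimono[of "Suc j" m p] by (metis not_less_eq_eq subsetD)
  moreover have "z \<in> powers p j"
  proof (cases j)
    case 0
    then show ?thesis using subgroup.mem_carrier[OF subgroup_powers z(1)] by (auto simp: multiples_def)
  next
    case (Suc l)
    then show ?thesis unfolding j_def using not_less_Least by (metis lessI)
  qed
  ultimately show ?thesis using j i by (auto simp: has_finite_height_def)
qed

lemma mem_powers_iff_le_height:
  assumes "has_finite_height p z m"
  shows "z \<in> powers p j \<longleftrightarrow> j \<le> m"
proof
  show "j \<le> m" if "z \<in> powers p j"
    using that assms powers_antimono[of "Suc m" j p] unfolding has_finite_height_def
    by (metis not_less_eq_eq subsetD)
  show "z \<in> powers p j" if "j \<le> m"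
    using that assms powers_antimono[of j m p] by (auto simp: has_finite_height_def)
qed

text \<open>
  An element of the divisible part is a \<open>p\<^sup>m\<^sup>+\<^sup>1\<close>-th power for every \<open>m\<close>, so a finite height
  excludes the value \<open>\<infinity>\<close>; the uniqueness in \<open>height_exists\<close> then identifies the ordinal.
\<close>

lemma height_eq_ord_of_nat:
  assumes p: "Factorial_Ring.prime p" "p_group p G" and h: "has_finite_height p z m"
  shows "height p G z = Fin (ord_of_nat m)"
proof -
  have z: "z \<in> carrier G"
    using h subgroup.mem_carrier[OF subgroup_powers] by (auto simp: has_finite_height_def)
  have nd: "z \<notin> divisible_part G"
  proof
    assume "z \<in> divisible_part G"
    then obtain D where D: "subgroup D G" "\<forall>m > 0. \<forall>d \<in> D. \<exists>c \<in> D. c [^] (m::nat) = d" "z \<in> D"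
      by (auto simp: divisible_part_def divisible_subgroup_def)
    moreover have "p ^ Suc m > 0" using prime_gt_0_nat[OF p(1)] by simp
    ultimately obtain c where c: "c \<in> D" "c [^] (p ^ Suc m) = z" by blast
    then have "z \<in> powers p (Suc m)" using powersI subgroup.mem_carrier[OF D(1)] by metis
    then show False using h by (simp add: has_finite_height_def)
  qed
  have "z \<in> ulm_power p G (ord_of_nat m) - ulm_power p G (osucc (ord_of_nat m))"
    using h by (simp add: has_finite_height_def ulm_power_ord_of_nat flip: ord_of_nat.simps(2))
  then have "(THE \<sigma>. z \<in> ulm_power p G \<sigma> - ulm_power p G (osucc \<sigma>)) = ord_of_nat m"
    by (rule the1_equality[OF height_exists[OF p z nd]])
  then show ?thesis using nd by (simp add: height_def)
qed

section \<open>Complements of cyclic subgroups\<close>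

lemma subgroup_pow_closed: "subgroup K G \<Longrightarrow> z \<in> K \<Longrightarrow> z [^] (r::nat) \<in> K"
  using subgroup_int_pow_closed[of K z "int r"] by (simp add: int_pow_int)

text \<open>
  The powers of \<open>a\<close> form a cyclic \<open>p\<close>-group, whose subgroups form a chain: by Bezout,
  \<open>a\<^sup>t\<close> generates the same subgroup as \<open>a\<close> raised to the largest power of \<open>p\<close> that divides
  \<open>t\<close> and the order.
\<close>

lemma prime_power_in_subgroup:
  assumes p: "Factorial_Ring.prime p" and a: "a \<in> carrier G" "a [^] (p ^ N) = \<one>"
    and K: "subgroup K G" and t: "a [^] (t::int) \<in> K" "\<not> int (p ^ Suc i) dvd t"
  shows "a [^] (p ^ i) \<in> K"
proof -
  have "gcd t (int (p ^ N)) = int (gcd (nat \<bar>t\<bar>) (p ^ N))"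
    unfolding gcd_int_def by (simp only: abs_of_nat nat_int)
  moreover obtain j where j: "gcd (nat \<bar>t\<bar>) (p ^ N) = p ^ j"
    using divides_primepow_nat[OF p] gcd_dvd2 by metis
  ultimately have gcd: "gcd t (int (p ^ N)) = int (p ^ j)" by (simp only:)
  obtain u v where "u * t + v * int (p ^ N) = gcd t (int (p ^ N))"
    using bezout_int by blast
  then have uv: "u * t + v * int (p ^ N) = int (p ^ j)" by (simp only: gcd)
  have one: "a [^] int (p ^ N) = \<one>" using a(2) by (metis int_pow_int)
  have "(a [^] t) [^] u \<otimes> (a [^] int (p ^ N)) [^] v = a [^] int (p ^ j)"
    using a(1) uv by (simp only: int_pow_pow int_pow_mult[symmetric] mult.commute)
  moreover have "(a [^] t) [^] u \<in> K" by (rule subgroup_int_pow_closed[OF K t(1)])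
  ultimately have mem: "a [^] (p ^ j) \<in> K"
    unfolding one using a(1) by (simp add: int_pow_int del: of_nat_power)
  have "\<not> Suc i \<le> j"
  proof
    assume "Suc i \<le> j"
    then have "int (p ^ Suc i) dvd int (p ^ j)" unfolding int_dvd_int_iff by (rule le_imp_power_dvd)
    moreover have "int (p ^ j) dvd t" using gcd by (metis gcd_dvd1)
    ultimately show False using t(2) dvd_trans by blast
  qed
  then have "a [^] (p ^ i) = (a [^] (p ^ j)) [^] (p ^ (i - j))"
    using a(1) by (simp add: nat_pow_pow flip: power_add)
  then show ?thesis using subgroup_pow_closed[OF K mem] by simp
qed

text \<open>
  A nontrivial subgroup of a cyclic \<open>p\<close>-group contains the socle. Thus, to show that a subgroup is
  independent of \<open>\<langle>a\<rangle>\<close>, only the single element \<open>a [^] (p ^ m)\<close> has to be excluded.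
\<close>

lemma socle_in_subgroup:
  assumes "Factorial_Ring.prime p" "a \<in> carrier G" "ord a = p ^ Suc m"
    and "subgroup K G" "a [^] (r::int) \<in> K" "a [^] r \<noteq> \<one>"
  shows "a [^] (p ^ m) \<in> K"
  using assms prime_power_in_subgroup[of p a "Suc m" K r m] pow_ord_eq_1[of a]
  by (metis int_pow_eq_id)

lemma subset_set_mult:
  assumes "subgroup H G" "subgroup K G"
  shows "H \<subseteq> H <#> K" and "K \<subseteq> H <#> K"
proof -
  show "H \<subseteq> H <#> K"
  proof
    fix h assume h: "h \<in> H"
    then have "h = h \<otimes> \<one>" using subgroup.mem_carrier[OF assms(1)] by simp
    then show "h \<in> H <#> K" using h subgroup.one_closed[OF assms(2)] unfolding set_mult_def by blast
  qed
  show "K \<subseteq> H <#> K"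
  proof
    fix k assume k: "k \<in> K"
    then have "k = \<one> \<otimes> k" using subgroup.mem_carrier[OF assms(2)] by simp
    then show "k \<in> H <#> K" using k subgroup.one_closed[OF assms(1)] unfolding set_mult_def by blast
  qed
qed

text \<open>
  By Zorn's lemma take \<open>K\<close> maximal among the subgroups above \<open>L\<close> that avoid \<open>a [^] (p ^ m)\<close>; it meets
  \<open>\<langle>a\<rangle>\<close> trivially. If \<open>\<langle>a\<rangle> <#> K\<close> is not everything, some \<open>w\<close> outside it has
  \<open>w\<^sup>p = a\<^sup>r \<otimes> k\<close>. As \<open>K\<close> contains the \<open>p\<^sup>m\<^sup>+\<^sup>1\<close>-th powers, \<open>p\<close> divides \<open>r\<close>, so that \<open>w\<close>
  can be corrected by a power of \<open>a\<close> to an element \<open>g\<close> outside the product with \<open>g\<^sup>p\<close> in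
  \<open>K\<close>. The subgroup generated by \<open>K\<close> and \<open>g\<close> still avoids \<open>a [^] (p ^ m)\<close>, contrary to the
  maximality of \<open>K\<close>.

  The freedom to prescribe \<open>L\<close> is what later allows two generators to be treated independently.
\<close>

lemma complement_of_cyclic:
  assumes p: "Factorial_Ring.prime p" and a: "a \<in> carrier G" "ord a = p ^ Suc m"
    and L: "subgroup L G" "powers p (Suc m) \<subseteq> L" "a [^] (p ^ m) \<notin> L"
  shows "\<exists>K. subgroup K G \<and> L \<subseteq> K \<and> generate G {a} \<inter> K = {\<one>} \<and> generate G {a} <#> K = carrier G"
proof -
  let ?s = "a [^] (p ^ m)"
  define F where "F = {K. subgroup K G \<and> L \<subseteq> K \<and> ?s \<notin> K}"
  have "\<Union>C \<in> F" if C: "C \<noteq> {}" "subset.chain F C" for C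
  proof -
    have CF: "C \<subseteq> F" and tot: "\<And>X Y. X \<in> C \<Longrightarrow> Y \<in> C \<Longrightarrow> X \<subseteq> Y \<or> Y \<subseteq> X"
      using C(2) by (auto simp: subset.chain_def)
    have sub: "subgroup X G" if "X \<in> C" for X using that CF by (auto simp: F_def)
    have "subgroup (\<Union>C) G"
    proof (rule subgroupI)
      show "\<Union>C \<subseteq> carrier G" using sub subgroup.subset by blast
      show "\<Union>C \<noteq> {}" using C(1) sub subgroup.one_closed by blast
      show "inv u \<in> \<Union>C" if "u \<in> \<Union>C" for u
        using that by (auto intro: subgroup.m_inv_closed[OF sub])
      show "u \<otimes> v \<in> \<Union>C" if uv: "u \<in> \<Union>C" "v \<in> \<Union>C" for u v
      proof -
        obtain X Y where "X \<in> C" "u \<in> X" "Y \<in> C" "v \<in> Y" using uv by blast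
        then obtain Z where "Z \<in> C" "u \<in> Z" "v \<in> Z" using tot by blast
        then show ?thesis using subgroup.m_closed[OF sub] by blast
      qed
    qed
    then show ?thesis using C(1) CF by (auto simp: F_def)
  qed
  moreover have "L \<in> F" using L by (simp add: F_def)
  ultimately obtain K where KF: "K \<in> F" and max: "\<And>X. X \<in> F \<Longrightarrow> K \<subseteq> X \<Longrightarrow> X = K"
    using subset_Zorn_nonempty[of F] by (metis empty_iff)
  have K: "subgroup K G" "L \<subseteq> K" "?s \<notin> K" using KF by (auto simp: F_def)
  have trivial: "a [^] r = \<one>" if "a [^] r \<in> K" for r :: int
    using socle_in_subgroup[OF p a K(1) that] K(3) by blast
  have A: "subgroup (generate G {a}) G" using a(1) by (simp add: generate_is_subgroup)
  define T where "T = generate G {a} <#> K"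
  have T: "subgroup T G" unfolding T_def by (rule mult_subgroups[OF A K(1)])
  have T_eq: "z \<in> T \<longleftrightarrow> (\<exists>r::int. \<exists>k \<in> K. z = a [^] r \<otimes> k)" for z
    by (auto simp: T_def set_mult_def generate_pow[OF a(1)])
  have KT: "K \<subseteq> T" unfolding T_def by (rule subset_set_mult(2)[OF A K(1)])
  have aT: "a [^] r \<in> T" for r :: int
    using subset_set_mult(1)[OF A K(1)] generate_pow[OF a(1)] by (auto simp: T_def)
  have "carrier G \<subseteq> T"
  proof (rule ccontr)
    assume "\<not> carrier G \<subseteq> T"
    then obtain z where z: "z \<in> carrier G" "z \<notin> T" by blast
    have "z [^] (p ^ Suc m) \<in> T" using z(1) powersI L(2) K(2) KT by blast
    \<comment> \<open>\<open>w\<close> is the last of the iterated \<open>p\<close>-th powers of \<open>z\<close> outside \<open>T\<close>\<close>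
    then obtain w where w: "w \<in> carrier G" "w \<notin> T" "w [^] p \<in> T"
    proof -
      define j where "j = (LEAST j. z [^] (p ^ j) \<in> T)"
      have "z [^] (p ^ j) \<in> T" unfolding j_def by (rule LeastI) fact
      moreover from this have "j \<noteq> 0" using z by (metis nat_pow_eone power_0)
      ultimately obtain i where i: "j = Suc i" "z [^] (p ^ Suc i) \<in> T" by (cases j) auto
      have "z [^] (p ^ i) \<notin> T" using i(1) unfolding j_def by (metis lessI not_less_Least)
      moreover have "(z [^] (p ^ i)) [^] p \<in> T"
        using i(2) z(1) by (simp add: nat_pow_pow mult.commute)
      ultimately show ?thesis using that z(1) by blast
    qed
    obtain r k where rk: "k \<in> K" "w [^] p = a [^] (r::int) \<otimes> k" using w(3) T_eq by blast
    have kG: "k \<in> carrier G" by (rule subgroup.mem_carrier[OF K(1) rk(1)])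
    \<comment> \<open>a \<open>p\<^sup>m\<close>-th power puts \<open>a [^] (r * p ^ m)\<close> into \<open>K\<close>, where only \<open>\<one>\<close> is a power of \<open>a\<close>\<close>
    have "w [^] (p ^ Suc m) = (a [^] r \<otimes> k) [^] (p ^ m)"
      using w(1) by (simp add: nat_pow_pow flip: rk(2))
    also have "\<dots> = a [^] (r * int (p ^ m)) \<otimes> k [^] (p ^ m)"
      using a(1) kG by (simp add: int_pow_distrib int_pow_pow flip: int_pow_int)
    finally have "a [^] (r * int (p ^ m)) = w [^] (p ^ Suc m) \<otimes> inv (k [^] (p ^ m))"
      using a(1) kG w(1) by (simp add: m_assoc)
    moreover have "w [^] (p ^ Suc m) \<in> K" using w(1) powersI L(2) K(2) by blast
    moreover have "inv (k [^] (p ^ m)) \<in> K"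
      by (intro subgroup.m_inv_closed[OF K(1)] subgroup_pow_closed[OF K(1) rk(1)])
    ultimately have "a [^] (r * int (p ^ m)) \<in> K" by (simp add: subgroup.m_closed[OF K(1)])
    then have "int (p ^ Suc m) dvd r * int (p ^ m)"
      using trivial a int_pow_eq_id by metis
    then have "int p dvd r" using prime_gt_0_nat[OF p] by simp
    then obtain q where q: "r = q * int p" by (metis dvdE mult.commute)
    define g where "g = w \<otimes> a [^] (- q)"
    have g: "g \<in> carrier G" using w(1) a(1) by (simp add: g_def)
    have "w = g \<otimes> a [^] q"
      using w(1) a(1) by (simp add: g_def m_assoc int_pow_neg)
    then have gT: "g \<notin> T" using w(2) aT T subgroup.m_closed by metis
    have "g [^] p = w [^] p \<otimes> a [^] (- r)"
      using w(1) a(1) by (simp add: g_def int_pow_distrib int_pow_pow q flip: int_pow_int)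
    then have "g [^] p = k"
      using rk(2) a(1) kG by (simp add: int_pow_neg m_ac)
    then have gp: "g [^] p \<in> K" using rk(1) by simp
    define K' where "K' = generate G {g} <#> K"
    have K'_eq: "z \<in> K' \<longleftrightarrow> (\<exists>r::int. \<exists>k \<in> K. z = g [^] r \<otimes> k)" for z
      by (auto simp: K'_def set_mult_def generate_pow[OF g])
    have K': "subgroup K' G"
      unfolding K'_def using mult_subgroups generate_is_subgroup g K(1) by simp
    have Gg: "subgroup (generate G {g}) G" using g by (simp add: generate_is_subgroup)
    have "K \<subseteq> K'" unfolding K'_def by (rule subset_set_mult(2)[OF Gg K(1)])
    moreover have "g \<in> K'"
      unfolding K'_def using subset_set_mult(1)[OF Gg K(1)] generate.incl[of g "{g}" G] by auto
    ultimately have "?s \<in> K'" using max[of K'] K' K(2) gT KT by (auto simp: F_def)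
    then obtain t l where tl: "l \<in> K" "?s = g [^] (t::int) \<otimes> l" using K'_eq by blast
    have lG: "l \<in> carrier G" by (rule subgroup.mem_carrier[OF K(1) tl(1)])
    have gpi: "g [^] int p \<in> K" using gp by (simp add: int_pow_int)
    show False
    proof (cases "int p dvd t")
      case True
      then obtain u where "t = int p * u" by blast
      then have "g [^] t \<in> K"
        using subgroup_int_pow_closed[OF K(1) gpi, of u] g by (simp add: int_pow_pow)
      then show False using tl K(1,3) subgroup.m_closed by metis
    next
      case False
      then have "coprime (int p) t" using p by (simp add: prime_imp_coprime)
      then obtain u v where uv: "u * int p + v * t = 1" using bezout_int[of "int p" t] by auto
      have "g [^] t = ?s \<otimes> inv l" using tl(2) g a(1) lG by (simp add: m_assoc)
      moreover have "?s \<in> T" using aT[of "int (p ^ m)"] by (simp add: int_pow_int del: of_nat_power)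
      moreover have "inv l \<in> T" using tl(1) KT by (auto intro: subgroup.m_inv_closed[OF T])
      ultimately have "g [^] t \<in> T" using T subgroup.m_closed by metis
      then have "(g [^] int p) [^] u \<otimes> (g [^] t) [^] v \<in> T"
        using gpi KT by (blast intro: subgroup.m_closed[OF T] subgroup_int_pow_closed[OF T])
      moreover have "(g [^] int p) [^] u \<otimes> (g [^] t) [^] v = g"
        using g uv by (simp only: int_pow_pow int_pow_mult[symmetric]) (simp add: mult.commute)
      ultimately show False using gT by simp
    qed
  qed
  then have "T = carrier G" using subgroup.subset[OF T] by blast
  moreover have "generate G {a} \<inter> K = {\<one>}"
    using trivial subgroup.one_closed[OF A] subgroup.one_closed[OF K(1)]
    by (auto simp: generate_pow[OF a(1)])
  ultimately show ?thesis using K unfolding T_def by blast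
qed

section \<open>Homomorphisms from cyclic subgroups\<close>

text \<open>
  The decomposition \<open>a\<^sup>r \<otimes> k\<close> determines \<open>a\<^sup>r\<close>, and therefore \<open>c\<^sup>r\<close>. For \<open>K = {\<one>}\<close> this is the
  homomorphism from \<open>\<langle>a\<rangle>\<close> with a given value at \<open>a\<close>.
\<close>

lemma hom_on_direct_product:
  assumes a: "a \<in> carrier G" and c: "c \<in> carrier G" "c [^] ord a = \<one>"
    and K: "subgroup K G" and indep: "\<And>r::int. a [^] r \<in> K \<Longrightarrow> a [^] r = \<one>"
  shows "\<exists>f. \<forall>r::int. \<forall>k \<in> K. f (a [^] r \<otimes> k) = c [^] r"
proof -
  define f where "f z = c [^] (SOME r::int. \<exists>k \<in> K. z = a [^] r \<otimes> k)" for z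
  have "f (a [^] r \<otimes> k) = c [^] r" if k: "k \<in> K" for r :: int and k
  proof -
    define s :: int where "s = (SOME s. \<exists>l \<in> K. a [^] r \<otimes> k = a [^] s \<otimes> l)"
    have "\<exists>s::int. \<exists>l \<in> K. a [^] r \<otimes> k = a [^] s \<otimes> l" using k by blast
    then have "\<exists>l \<in> K. a [^] r \<otimes> k = a [^] s \<otimes> l" unfolding s_def by (rule someI_ex)
    then obtain l where l: "l \<in> K" "a [^] r \<otimes> k = a [^] s \<otimes> l" by blast
    note kl = subgroup.mem_carrier[OF K k] subgroup.mem_carrier[OF K l(1)]
    have "a [^] (r - s) = inv (a [^] s) \<otimes> (a [^] r \<otimes> k) \<otimes> inv k"
      using a kl(1) by (simp add: int_pow_diff m_assoc) (simp add: m_comm)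
    also have "\<dots> = l \<otimes> inv k" unfolding l(2) using a kl by (simp add: m_assoc[symmetric])
    also have "\<dots> \<in> K" using K k l(1) by (simp add: subgroup.m_closed subgroup.m_inv_closed)
    finally have "int (ord a) dvd r - s" using indep int_pow_eq_id[OF a] by blast
    moreover have "int (ord c) dvd int (ord a)" using c by (simp add: pow_eq_id)
    ultimately have "c [^] s = c [^] r" using int_pow_eq[OF c(1)] dvd_trans by blast
    then show ?thesis unfolding f_def s_def .
  qed
  then show ?thesis by blast
qed

text \<open>
  Project onto \<open>\<langle>a\<rangle>\<close> along a complement that contains \<open>L\<close>, and then send \<open>a\<close> to \<open>c\<close>.
\<close>

lemma endomorphism_from_cyclic:
  assumes p: "Factorial_Ring.prime p" and a: "a \<in> carrier G" "ord a = p ^ Suc m"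
    and L: "subgroup L G"
    and indep: "\<And>w l. w \<in> carrier G \<Longrightarrow> l \<in> L \<Longrightarrow> a [^] (p ^ m) \<noteq> w [^] (p ^ Suc m) \<otimes> l"
    and c: "c \<in> carrier G" "c [^] (p ^ Suc m) = \<one>"
  shows "\<exists>g \<in> hom G G. g a = c \<and> (\<forall>l \<in> L. g l = \<one>)"
proof -
  let ?L = "powers p (Suc m) <#> L"
  have "subgroup ?L G" by (rule mult_subgroups[OF subgroup_powers L])
  moreover have "powers p (Suc m) \<subseteq> ?L"
    by (rule subset_set_mult(1)[OF subgroup_powers L])
  moreover have "a [^] (p ^ m) \<notin> ?L"
  proof
    assume "a [^] (p ^ m) \<in> ?L"
    then obtain v l where vl: "v \<in> powers p (Suc m)" "l \<in> L" "a [^] (p ^ m) = v \<otimes> l"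
      unfolding set_mult_def by blast
    from vl(1) obtain w where "w \<in> carrier G" "v = w [^] (p ^ Suc m)"
      unfolding mem_powers_iff by blast
    then show False using indep vl(2,3) by blast
  qed
  ultimately obtain K where K: "subgroup K G" "?L \<subseteq> K" "generate G {a} \<inter> K = {\<one>}"
      "generate G {a} <#> K = carrier G"
    using complement_of_cyclic[OF p a, of ?L] by blast
  have "a [^] r = \<one>" if "a [^] r \<in> K" for r :: int
    using that K(3) by (auto simp: generate_pow[OF a(1)])
  then have "\<exists>f. \<forall>r::int. \<forall>k \<in> K. f (a [^] r \<otimes> k) = c [^] r"
    using a c by (intro hom_on_direct_product[OF a(1) c(1) _ K(1)]) auto
  then obtain f where f: "\<And>r k. k \<in> K \<Longrightarrow> f (a [^] (r::int) \<otimes> k) = c [^] r" by blast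
  have split: "\<exists>r::int. \<exists>k \<in> K. z = a [^] r \<otimes> k" if "z \<in> carrier G" for z
    using that unfolding K(4)[symmetric] by (auto simp: set_mult_def generate_pow[OF a(1)])
  have LK: "L \<subseteq> K"
    using K(2) subset_set_mult(2)[OF subgroup_powers L] by blast
  have "f \<in> hom G G"
  proof (rule homI)
    fix z assume "z \<in> carrier G"
    then show "f z \<in> carrier G" using split f c(1) by fastforce
  next
    fix y z assume "y \<in> carrier G" "z \<in> carrier G"
    then obtain r k s l where eq: "k \<in> K" "l \<in> K" "y = a [^] (r::int) \<otimes> k" "z = a [^] (s::int) \<otimes> l"
      using split by metis
    then have "k \<in> carrier G" "l \<in> carrier G" using subgroup.mem_carrier[OF K(1)] by auto
    then have "y \<otimes> z = a [^] (r + s) \<otimes> (k \<otimes> l)"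
      using a(1) by (simp add: eq int_pow_mult m_ac)
    then show "f (y \<otimes> z) = f y \<otimes> f z"
      using f eq c(1) subgroup.m_closed[OF K(1)] by (simp add: int_pow_mult)
  qed
  moreover have "f a = c"
    using f[OF subgroup.one_closed[OF K(1)], of 1] a(1) c(1) by simp
  moreover have "f l = \<one>" if "l \<in> L" for l
    using f[of l 0] that LK subgroup.mem_carrier[OF L that] by auto
  ultimately show ?thesis by blast
qed

text \<open>
  If the socle of \<open>\<langle>x\<rangle>\<close> has no larger height in the group than in \<open>\<langle>x\<rangle>\<close>, then \<open>\<langle>x\<rangle>\<close> is a direct
  summand.
\<close>

lemma endomorphism_of_pure_cyclic:
  assumes p: "Factorial_Ring.prime p" and x: "x \<in> carrier G" "ord x = p ^ Suc m"
    and h: "x [^] (p ^ m) \<notin> powers p (Suc m)"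
    and y: "y \<in> carrier G" "y [^] (p ^ Suc m) = \<one>"
  shows "\<exists>g \<in> hom G G. g x = y"
proof -
  have "x [^] (p ^ m) \<noteq> w [^] (p ^ Suc m) \<otimes> l" if "w \<in> carrier G" "l \<in> {\<one>}" for w l
    using that h powersI[of w p "Suc m"] by auto
  then show ?thesis
    using endomorphism_from_cyclic[OF p x triv_subgroup _ y] by blast
qed

section \<open>Cyclic summands and gaps\<close>

lemma ord_prime_power:
  assumes p: "Factorial_Ring.prime p" and a: "a \<in> carrier G"
    and one: "a [^] (p ^ Suc m) = \<one>" and neq: "a [^] (p ^ m) \<noteq> \<one>"
  shows "ord a = p ^ Suc m"
proof -
  obtain j where j: "j \<le> Suc m" "ord a = p ^ j"
    using one a divides_primepow_nat[OF p] pow_eq_id by blast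
  have "\<not> j \<le> m"
    using neq j(2) a le_imp_power_dvd[of j m p] by (auto simp: pow_eq_id)
  then show ?thesis using j by (simp add: le_antisym not_less_eq_eq)
qed

text \<open>
  If \<open>u = a [^] (p ^ m)\<close>, then \<open>u\<close> generates the socle of \<open>\<langle>a\<rangle>\<close>, and \<open>complement_of_cyclic\<close> applies with
  \<open>L\<close> the subgroup of \<open>p\<^sup>m\<^sup>+\<^sup>1\<close>-th powers.
\<close>

lemma cyclic_summand_of_socle:
  assumes p: "Factorial_Ring.prime p" and u: "u \<noteq> \<one>" "u [^] p = \<one>"
    and h: "u \<in> powers p m" "u \<notin> powers p (Suc m)"
  shows "has_cyclic_summand p G (Suc m)"
proof -
  obtain a where a: "a \<in> carrier G" "u = a [^] (p ^ m)" using h(1) by (auto simp: mem_powers_iff)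
  have ord: "ord a = p ^ Suc m"
    by (rule ord_prime_power[OF p a(1)]) (use u a in \<open>simp_all add: nat_pow_pow mult.commute\<close>)
  obtain K where K: "subgroup K G" "generate G {a} \<inter> K = {\<one>}" "generate G {a} <#> K = carrier G"
    using complement_of_cyclic[OF p a(1) ord subgroup_powers order_refl] h(2) a(2) by auto
  let ?H = "generate G {a}"
  have H: "subgroup ?H G" using a(1) by (simp add: generate_is_subgroup)
  have aH: "a \<in> ?H" by (simp add: generate.incl)
  have range: "?H = range (\<lambda>r::int. a [^]\<^bsub>G\<lparr>carrier := ?H\<rparr>\<^esub> r)"
    by (simp flip: int_pow_consistent[OF H aH]) (auto simp: generate_pow[OF a(1)])
  have "cyclic_group (G\<lparr>carrier := ?H\<rparr>)"
    unfolding group.cyclic_group[OF subgroup_imp_group[OF H]]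
    by (rule bexI[of _ a]) (simp_all add: aH range[symmetric])
  moreover have "order (G\<lparr>carrier := ?H\<rparr>) = p ^ Suc m"
    using generate_pow_card[OF a(1)] ord by (simp add: order_def)
  ultimately show ?thesis
    using K H unfolding has_cyclic_summand_def direct_summand_def by blast
qed

text \<open>
  Direct summands are pure: heights of elements of \<open>\<langle>c\<rangle>\<close> can be computed inside \<open>\<langle>c\<rangle>\<close>, where
  \<open>c [^] (p ^ i)\<close> is no \<open>p\<^sup>i\<^sup>+\<^sup>1\<close>-th power.
\<close>

lemma cyclic_summand_generator:
  assumes p: "Factorial_Ring.prime p" and "has_cyclic_summand p G e"
  shows "\<exists>c \<in> carrier G. ord c = p ^ e \<and> (\<forall>i<e. c [^] (p ^ i) \<notin> powers p (Suc i))"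
proof -
  obtain H K where H: "subgroup H G" "cyclic_group (G\<lparr>carrier := H\<rparr>)"
      "order (G\<lparr>carrier := H\<rparr>) = p ^ e"
    and K: "subgroup K G" "H \<inter> K = {\<one>}" "H <#> K = carrier G"
    using assms(2) unfolding has_cyclic_summand_def direct_summand_def by blast
  obtain c where c: "c \<in> H" "H = range (\<lambda>n::int. c [^]\<^bsub>G\<lparr>carrier := H\<rparr>\<^esub> n)"
    using H(2) unfolding group.cyclic_group[OF subgroup_imp_group[OF H(1)]] by auto
  have cG: "c \<in> carrier G" by (rule subgroup.mem_carrier[OF H(1) c(1)])
  have H_eq: "H = range (\<lambda>n::int. c [^] n)"
    using c int_pow_consistent[OF H(1) c(1)] by simp
  then have "generate G {c} = H" using generate_pow[OF cG] by auto
  then have ord: "ord c = p ^ e" using H(3) generate_pow_card[OF cG] by (simp add: order_def)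
  have "c [^] (p ^ i) \<notin> powers p (Suc i)" if i: "i < e" for i
  proof
    assume "c [^] (p ^ i) \<in> powers p (Suc i)"
    then obtain w where w: "w \<in> carrier G" "c [^] (p ^ i) = w [^] (p ^ Suc i)"
      unfolding mem_powers_iff by blast
    obtain r k where rk: "k \<in> K" "w = c [^] (r::int) \<otimes> k"
      using w(1) K(3) H_eq by (force simp: set_mult_def)
    have kG: "k \<in> carrier G" by (rule subgroup.mem_carrier[OF K(1) rk(1)])
    let ?d = "int (p ^ i) - r * int (p ^ Suc i)"
    have "c [^] int (p ^ i) = c [^] (r * int (p ^ Suc i)) \<otimes> k [^] (p ^ Suc i)"
      using w(2) cG kG by (simp add: rk(2) int_pow_distrib int_pow_pow flip: int_pow_int)
    then have "c [^] ?d = k [^] (p ^ Suc i)"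
      using cG kG by (simp add: int_pow_diff m_ac del: power_Suc of_nat_power)
    moreover have "k [^] (p ^ Suc i) \<in> K" by (rule subgroup_pow_closed[OF K(1) rk(1)])
    ultimately have "c [^] ?d \<in> H \<inter> K" using H_eq by (metis IntI rangeI)
    then have "int (p ^ e) dvd ?d" using K(2) ord int_pow_eq_id[OF cG] by auto
    moreover have "int (p ^ Suc i) dvd int (p ^ e)"
      using i unfolding int_dvd_int_iff by (intro le_imp_power_dvd) simp
    ultimately have "int (p ^ Suc i) dvd ?d" using dvd_trans by blast
    moreover have "?d = int (p ^ i) * (1 - r * int p)" by (simp add: algebra_simps)
    ultimately have "int p dvd 1 - r * int p"
      using prime_gt_0_nat[OF p] by (simp add: mult.commute)
    then have "int p dvd 1" by (metis dvd_diff_left_iff dvd_triv_right)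
    then show False using p by auto
  qed
  then show ?thesis using cG ord by blast
qed

text \<open>
  Write \<open>z\<^sup>p = v\<^sup>p\<close> with \<open>v\<close> a \<open>p\<^sup>m\<^sup>+\<^sup>1\<close>-th power. Then \<open>z \<otimes> inv v\<close> has order \<open>p\<close>, and its
  height is that of \<open>z\<close>. The case \<open>z\<^sup>p = \<one>\<close>, the trivial gap of an Ulm sequence, is included.
\<close>

lemma cyclic_summand_of_gap:
  assumes p: "Factorial_Ring.prime p"
    and z: "z \<in> powers p m" "z \<notin> powers p (Suc m)" "z [^] p \<in> powers p (Suc (Suc m))"
  shows "has_cyclic_summand p G (Suc m)"
proof -
  have zG: "z \<in> carrier G" by (rule subgroup.mem_carrier[OF subgroup_powers z(1)])
  obtain w where w: "w \<in> carrier G" "z [^] p = w [^] (p ^ Suc (Suc m))"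
    using z(3) unfolding mem_powers_iff by blast
  define v where "v = w [^] (p ^ Suc m)"
  have v: "v \<in> carrier G" "v [^] p = z [^] p" "v \<in> powers p (Suc m)"
    using w powersI[of w p "Suc m"] by (simp_all add: v_def nat_pow_pow ac_simps)
  have v': "v \<in> powers p m" using v(3) powers_antimono[of m "Suc m" p] by auto
  define u where "u = z \<otimes> inv v"
  have zu: "z = u \<otimes> v" using zG v(1) by (simp add: u_def m_assoc)
  show ?thesis
  proof (rule cyclic_summand_of_socle[OF p])
    show "u \<notin> powers p (Suc m)"
      using zu z(2) subgroup.m_closed[OF subgroup_powers _ v(3)] by auto
    then show "u \<noteq> \<one>" using subgroup.one_closed[OF subgroup_powers] by blast
    show "u \<in> powers p m" unfolding u_def
      using subgroup.m_closed[OF subgroup_powers z(1) subgroup.m_inv_closed[OF subgroup_powers v']] .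
    show "u [^] p = \<one>"
      using zG v by (simp add: u_def nat_pow_distrib nat_pow_inv)
  qed
qed

text \<open>
  Descending from \<open>y [^] (p ^ n) = \<one>\<close>: the last exponent \<open>i\<close> at which \<open>y [^] (p ^ i)\<close> has height below
  \<open>i + l\<close> would be followed by a gap, and the resulting cyclic summand has an exponent between
  \<open>i + 1\<close> and \<open>i + l\<close>.
\<close>

lemma pow_mem_powers_of_no_summand:
  assumes p: "Factorial_Ring.prime p" and y: "y \<in> carrier G" "y [^] (p ^ n) = \<one>"
    and k: "k \<le> n" and no: "\<And>e. Suc k \<le> e \<Longrightarrow> e < n + l \<Longrightarrow> \<not> has_cyclic_summand p G e"
  shows "y [^] (p ^ k) \<in> powers p (k + l)"
  using k
proof (induction rule: inc_induct)
  case base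
  then show ?case using y subgroup.one_closed[OF subgroup_powers] by simp
next
  case (step i)
  show ?case
  proof (rule ccontr)
    assume "y [^] (p ^ i) \<notin> powers p (i + l)"
    then obtain m where m: "i \<le> m" "m < i + l" "has_finite_height p (y [^] (p ^ i)) m"
      using finite_height_exists powersI[OF y(1)] by metis
    have "(y [^] (p ^ i)) [^] p \<in> powers p (Suc i + l)"
      using step.IH y(1) by (simp add: nat_pow_pow mult.commute)
    then have "(y [^] (p ^ i)) [^] p \<in> powers p (Suc (Suc m))"
      using m(2) powers_antimono[of "Suc (Suc m)" "Suc i + l" p] by auto
    then have "has_cyclic_summand p G (Suc m)"
      using m(3) unfolding has_finite_height_def by (intro cyclic_summand_of_gap[OF p]) auto
    then show False using no[of "Suc m"] m step.hyps by simp
  qed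
qed

section \<open>Consequences of the extension of monomorphisms\<close>

text \<open>
  The map \<open>x\<^sup>r \<mapsto> y\<^sup>r\<close> is a monomorphism on \<open>\<langle>x\<rangle>\<close> because the orders agree.
\<close>

lemma endomorphism_of_P_subgroup:
  assumes P: "generate G {x} \<in> P_subgroups G"
    and x: "x \<in> carrier G" and y: "y \<in> carrier G" "ord y = ord x"
  shows "\<exists>g \<in> hom G G. g x = y"
proof -
  let ?N = "generate G {x}"
  have xN: "x \<in> ?N" by (simp add: generate.incl)
  have one: "subgroup {\<one>} G" by (rule triv_subgroup)
  obtain f where "\<And>r k. k \<in> {\<one>} \<Longrightarrow> f (x [^] (r::int) \<otimes> k) = y [^] r"
    using hom_on_direct_product[OF x y(1) _ one] y pow_ord_eq_1[of y] by auto
  then have f: "f (x [^] (r::int)) = y [^] r" for r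
    using x by (metis int_pow_closed r_one singletonI)
  have elem: "\<exists>r::int. z = x [^] r" if "z \<in> ?N" for z
    using that by (auto simp: generate_pow[OF x])
  have "f u \<in> carrier G" if "u \<in> ?N" for u
    using elem[OF that] f y(1) by auto
  moreover have "f (u \<otimes> v) = f u \<otimes> f v \<and> (f u = f v \<longrightarrow> u = v)" if uvN: "u \<in> ?N" "v \<in> ?N" for u v
  proof -
    obtain r s :: int where uv: "u = x [^] r" "v = x [^] s" using elem uvN by metis
    have "u \<otimes> v = x [^] (r + s)" using uv x by (simp add: int_pow_mult)
    then have "f (u \<otimes> v) = f u \<otimes> f v" using f uv y(1) by (simp add: int_pow_mult)
    then show ?thesis using f uv int_pow_eq[OF x] int_pow_eq[OF y(1)] y(2) by simp
  qed
  ultimately have "f \<in> mon (G\<lparr>carrier := ?N\<rparr>) G"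
    by (auto simp: mon_def hom_def inj_on_def)
  then obtain g where "g \<in> hom G G" "\<forall>z \<in> ?N. g z = f z" using P by (auto simp: P_subgroups_def)
  moreover have "f x = y" using f[of 1] x y by simp
  ultimately show ?thesis using xN by blast
qed

lemma powers_of_P_subgroup:
  assumes P: "generate G {x} \<in> P_subgroups G"
    and x: "x \<in> carrier G" and y: "y \<in> carrier G" "ord y = ord x"
    and h: "x [^] (p ^ i) \<in> powers p m"
  shows "y [^] (p ^ i) \<in> powers p m"
proof -
  obtain g where g: "g \<in> hom G G" "g x = y"
    using endomorphism_of_P_subgroup[OF P x y] by blast
  have "g (x [^] (p ^ i)) = y [^] (p ^ i)"
    using hom_nat_pow[OF g(1) x group_axioms group_axioms] g(2) by simp
  then show ?thesis using hom_powers[OF g(1) h] by simp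
qed

text \<open>
  Some element \<open>y\<close> built from a generator \<open>c\<close> of the summand has the order of \<open>x\<close>, yet
  a power of it has smaller height than the same power of \<open>x\<close>. This contradicts
  \<open>powers_of_P_subgroup\<close>.
\<close>

lemma no_cyclic_summand_of_P_subgroup:
  assumes p: "Factorial_Ring.prime p" and P: "generate G {x} \<in> P_subgroups G"
    and x: "x \<in> carrier G" "ord x = p ^ n"
    and k: "k < n" "x [^] (p ^ k) \<in> powers p (k + l)" and l: "l > 0"
    and e: "Suc k \<le> e" "e < n + l"
  shows "\<not> has_cyclic_summand p G e"
proof
  assume "has_cyclic_summand p G e"
  then obtain c where c: "c \<in> carrier G" "ord c = p ^ e"
    and hc: "\<And>i. i < e \<Longrightarrow> c [^] (p ^ i) \<notin> powers p (Suc i)"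
    using cyclic_summand_generator[OF p] by blast
  have p0: "p > 0" by (rule prime_gt_0_nat[OF p])
  show False
  proof (cases "e < n")
    case True
    obtain f where f: "e = Suc f" using e(1) by (cases e) auto
    have "x [^] (p ^ f) = (x [^] (p ^ k)) [^] (p ^ (f - k))"
      using x(1) e(1) f by (simp add: nat_pow_pow flip: power_add)
    then have "x [^] (p ^ f) \<in> powers p (k + l + (f - k))" using powers_pow[OF k(2)] by metis
    then have xf: "x [^] (p ^ f) \<in> powers p (Suc f)"
      using powers_antimono[of "Suc f" "k + l + (f - k)" p] l e(1) f by auto
    \<comment> \<open>here \<open>y = x \<otimes> c\<close>: the height of \<open>x [^] (p ^ f)\<close> exceeds that of \<open>c [^] (p ^ f)\<close>, which is \<open>f\<close>\<close>
    have "ord (x \<otimes> c) = ord x"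
    proof -
      obtain n' where n': "n = Suc n'" using k(1) by (cases n) auto
      have "c [^] (p ^ n') = \<one>" "c [^] (p ^ n) = \<one>"
        using c True n' by (simp_all add: pow_eq_id le_imp_power_dvd del: power_Suc)
      moreover have "x [^] (p ^ n') \<noteq> \<one>" "x [^] (p ^ n) = \<one>"
        using x n' prime_gt_1_nat[OF p] by (auto simp: pow_eq_id dest!: dvd_imp_le)
      ultimately have "ord (x \<otimes> c) = p ^ Suc n'"
        by (intro ord_prime_power[OF p]) (use x c n' in \<open>simp_all add: nat_pow_distrib del: power_Suc\<close>)
      then show ?thesis using x n' by simp
    qed
    then have "(x \<otimes> c) [^] (p ^ f) \<in> powers p (Suc f)"
      using powers_of_P_subgroup[OF P x(1) _ _ xf] x c by simp
    then have "inv (x [^] (p ^ f)) \<otimes> (x \<otimes> c) [^] (p ^ f) \<in> powers p (Suc f)"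
      using xf subgroup.m_closed[OF subgroup_powers] subgroup.m_inv_closed[OF subgroup_powers] by blast
    moreover have "inv (x [^] (p ^ f)) \<otimes> (x \<otimes> c) [^] (p ^ f) = c [^] (p ^ f)"
      using x c by (simp add: nat_pow_distrib flip: m_assoc)
    ultimately show False using hc[of f] f by simp
  next
    case False
    \<comment> \<open>the height of \<open>y [^] (p ^ k)\<close> is \<open>e - n + k\<close>, which is less than \<open>k + l\<close>\<close>
    define y where "y = c [^] (p ^ (e - n))"
    have "ord y = p ^ e div p ^ (e - n)"
      unfolding y_def using c p0 by (subst ord_pow) (auto intro: le_imp_power_dvd)
    moreover have "p ^ e = p ^ n * p ^ (e - n)" using False by (simp flip: power_add)
    ultimately have "ord y = ord x" using x(2) p0 by simp
    then have "y [^] (p ^ k) \<in> powers p (k + l)"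
      using powers_of_P_subgroup[OF P x(1) _ _ k(2)] c by (simp add: y_def)
    moreover have "y [^] (p ^ k) = c [^] (p ^ (e - n + k))"
      using c(1) by (simp add: y_def nat_pow_pow power_add)
    moreover have "powers p (k + l) \<subseteq> powers p (Suc (e - n + k))"
      using e(2) False by (intro powers_antimono) simp
    moreover have "e - n + k < e" using k(1) False by simp
    ultimately show False using hc[of "e - n + k"] by auto
  qed
qed

section \<open>Endomorphisms moving an element whose Ulm sequence has one gap\<close>

text \<open>
  Here \<open>x [^] (p ^ k) = a [^] (p ^ (k + l))\<close> for some \<open>a\<close>, and \<open>b = x \<otimes> inv (a [^] (p ^ l))\<close> has order
  \<open>p\<^sup>k\<close>. The assumptions \<open>high\<close> and \<open>low\<close> imply that the socles of \<open>\<langle>a\<rangle>\<close> and \<open>\<langle>b\<rangle>\<close> (for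
  \<open>k > 0\<close>) have the least possible heights \<open>n + l\<close> and \<open>k - 1\<close>. As these heights differ, the
  socle of either subgroup does not rise modulo the other one, so each generator can be moved by
  an endomorphism that kills the other generator. The product of the two endomorphisms sends \<open>x\<close>
  to \<open>y\<close>.
\<close>

lemma endomorphism_of_one_gap:
  assumes p: "Factorial_Ring.prime p" and x: "x \<in> carrier G" "ord x = p ^ Suc n"
    and k: "k \<le> n" "x [^] (p ^ k) \<in> powers p (k + l)" and l: "l > 0"
    and low: "\<And>j. k = Suc j \<Longrightarrow> x [^] (p ^ j) \<notin> powers p k"
    and high: "x [^] (p ^ n) \<notin> powers p (Suc (n + l))"
    and y: "y \<in> carrier G" "y [^] (p ^ Suc n) = \<one>" "y [^] (p ^ k) \<in> powers p (k + l)"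
  shows "\<exists>g \<in> hom G G. g x = y"
proof -
  let ?m = "n + l"
  obtain a where a: "a \<in> carrier G" "x [^] (p ^ k) = a [^] (p ^ (k + l))"
    using k(2) unfolding mem_powers_iff by blast
  obtain c where c: "c \<in> carrier G" "y [^] (p ^ k) = c [^] (p ^ (k + l))"
    using y(3) unfolding mem_powers_iff by blast
  have shift: "u [^] (p ^ j) = v [^] (p ^ (j + l))"
    if uv: "u \<in> carrier G" "v \<in> carrier G" "u [^] (p ^ k) = v [^] (p ^ (k + l))" and "k \<le> j" for u v j
  proof -
    have "(u [^] (p ^ k)) [^] (p ^ (j - k)) = (v [^] (p ^ (k + l))) [^] (p ^ (j - k))"
      by (simp only: uv(3))
    then show ?thesis using uv(1,2) \<open>k \<le> j\<close> by (simp add: nat_pow_pow add.commute flip: power_add)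
  qed
  have am: "a [^] (p ^ ?m) = x [^] (p ^ n)" using shift[OF x(1) a k(1)] by simp
  have a1: "a [^] (p ^ Suc ?m) = \<one>"
    using shift[OF x(1) a, of "Suc n"] k(1) x pow_ord_eq_1[of x] by simp
  have ah: "a [^] (p ^ ?m) \<notin> powers p (Suc ?m)" using am high by simp
  have orda: "ord a = p ^ Suc ?m"
    using ord_prime_power[OF p a(1) a1] ah subgroup.one_closed[OF subgroup_powers] by metis
  have c1: "c [^] (p ^ Suc ?m) = \<one>"
    using shift[OF y(1) c, of "Suc n"] k(1) y(2) by simp
  define b where "b = x \<otimes> inv (a [^] (p ^ l))"
  define d where "d = y \<otimes> inv (c [^] (p ^ l))"
  have b: "b \<in> carrier G" "x = b \<otimes> a [^] (p ^ l)"
    using x(1) a(1) by (simp_all add: b_def m_assoc)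
  have d: "d \<in> carrier G" "y = d \<otimes> c [^] (p ^ l)"
    using y(1) c(1) by (simp_all add: d_def m_assoc)
  have b1: "b [^] (p ^ k) = \<one>"
    using x(1) a by (simp add: b_def nat_pow_distrib nat_pow_inv nat_pow_pow power_add mult.commute)
  have d1: "d [^] (p ^ k) = \<one>"
    using y(1) c by (simp add: d_def nat_pow_distrib nat_pow_inv nat_pow_pow power_add mult.commute)
  have "\<exists>g \<in> hom G G. g a = c \<and> g b = d"
  proof (cases k)
    case 0
    then have "b = \<one>" "d = \<one>" using b1 d1 b(1) d(1) by simp_all
    moreover obtain g where "g \<in> hom G G" "g a = c"
      using endomorphism_of_pure_cyclic[OF p a(1) orda ah c(1) c1] by blast
    ultimately show ?thesis using hom_one[OF _ group_axioms group_axioms] by auto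
  next
    case (Suc j)
    have bh: "b [^] (p ^ j) \<notin> powers p k"
    proof
      assume bp: "b [^] (p ^ j) \<in> powers p k"
      have "(a [^] (p ^ l)) [^] (p ^ j) \<in> powers p (l + j)"
        using powers_pow powersI[OF a(1)] by blast
      then have "(a [^] (p ^ l)) [^] (p ^ j) \<in> powers p k"
        using powers_antimono[of k "l + j" p] Suc l by auto
      then have "x [^] (p ^ j) \<in> powers p k"
        using bp subgroup.m_closed[OF subgroup_powers] a(1) b by (simp add: nat_pow_distrib)
      then show False using low[OF Suc] by simp
    qed
    have ordb: "ord b = p ^ Suc j"
      using ord_prime_power[OF p b(1)] b1 bh subgroup.one_closed[OF subgroup_powers] Suc by metis
    have A: "subgroup (generate G {a}) G" and B: "subgroup (generate G {b}) G"
      using a(1) b(1) by (simp_all add: generate_is_subgroup)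
    \<comment> \<open>\<open>v\<close> would have height at least \<open>n + l \<ge> k\<close>, which among the powers of \<open>b\<close> only \<open>\<one>\<close> has\<close>
    have "a [^] (p ^ ?m) \<noteq> w [^] (p ^ Suc ?m) \<otimes> v" if w: "w \<in> carrier G" "v \<in> generate G {b}" for w v
    proof
      assume eq: "a [^] (p ^ ?m) = w [^] (p ^ Suc ?m) \<otimes> v"
      obtain s :: int where s: "v = b [^] s" using w(2) by (auto simp: generate_pow[OF b(1)])
      have wp: "w [^] (p ^ Suc ?m) \<in> powers p (Suc ?m)" by (rule powersI[OF w(1)])
      have "v = inv (w [^] (p ^ Suc ?m)) \<otimes> a [^] (p ^ ?m)"
        unfolding eq using w(1) b(1) s by (simp flip: m_assoc del: power_Suc)
      moreover have "w [^] (p ^ Suc ?m) \<in> powers p ?m" "a [^] (p ^ ?m) \<in> powers p ?m"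
        using wp powers_antimono[of ?m "Suc ?m" p] powersI[OF a(1)] by auto
      ultimately have "v \<in> powers p ?m"
        using subgroup.m_closed[OF subgroup_powers] subgroup.m_inv_closed[OF subgroup_powers] by metis
      then have "v \<in> powers p k" using powers_antimono[of k ?m p] k(1) by auto
      then have "v = \<one>" using socle_in_subgroup[OF p b(1) ordb subgroup_powers] bh s by blast
      then show False using ah wp eq w(1) by simp
    qed
    then obtain g where g: "g \<in> hom G G" "g a = c" "\<And>v. v \<in> generate G {b} \<Longrightarrow> g v = \<one>"
      using endomorphism_from_cyclic[OF p a(1) orda B _ c(1) c1] by blast
    \<comment> \<open>taking \<open>p\<close>-th powers removes \<open>b\<close>; purity of \<open>\<langle>a\<rangle>\<close> then makes \<open>v\<close> a \<open>p\<^sup>k\<close>-th power\<close>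
    have "b [^] (p ^ j) \<noteq> w [^] (p ^ Suc j) \<otimes> v" if w: "w \<in> carrier G" "v \<in> generate G {a}" for w v
    proof
      assume eq: "b [^] (p ^ j) = w [^] (p ^ Suc j) \<otimes> v"
      obtain s :: int where s: "v = a [^] s" using w(2) by (auto simp: generate_pow[OF a(1)])
      have "\<one> = (b [^] (p ^ j)) [^] p" using b1 b(1) Suc by (simp add: nat_pow_pow mult.commute)
      also have "\<dots> = w [^] (p ^ Suc k) \<otimes> a [^] (s * int p)"
        unfolding eq s using w(1) a(1) Suc by (simp add: int_pow_distrib int_pow_pow mult_ac flip: int_pow_int)
      finally have "a [^] (s * int p) = inv (w [^] (p ^ Suc k))"
        using w(1) a(1) by (metis int_pow_closed inv_equality m_comm nat_pow_closed)
      then have mem: "a [^] (s * int p) \<in> powers p (Suc k)"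
        using subgroup.m_inv_closed[OF subgroup_powers powersI[OF w(1)]] by metis
      have "int (p ^ Suc k) dvd s * int p"
      proof (rule ccontr)
        assume "\<not> int (p ^ Suc k) dvd s * int p"
        then have "a [^] (p ^ k) \<in> powers p (Suc k)"
          by (rule prime_power_in_subgroup[OF p a(1) a1 subgroup_powers mem])
        then have "(a [^] (p ^ k)) [^] (p ^ (?m - k)) \<in> powers p (Suc k + (?m - k))"
          by (rule powers_pow)
        then show False using ah a(1) k(1) by (simp add: nat_pow_pow flip: power_add)
      qed
      then have "int (p ^ k) dvd s" using prime_gt_0_nat[OF p] by (simp add: mult.commute)
      then obtain q where "s = q * int (p ^ k)" by (metis dvdE mult.commute)
      then have "v = (a [^] q) [^] (p ^ k)" using a(1) s by (simp add: int_pow_pow flip: int_pow_int)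
      then have "v \<in> powers p k" using powersI a(1) by simp
      then have "b [^] (p ^ j) \<in> powers p k"
        unfolding eq using subgroup.m_closed[OF subgroup_powers] powersI[OF w(1), of p k] Suc by metis
      then show False using bh by simp
    qed
    moreover have "d [^] (p ^ Suc j) = \<one>" using d1 Suc by simp
    ultimately obtain h where h: "h \<in> hom G G" "h b = d" "\<And>v. v \<in> generate G {a} \<Longrightarrow> h v = \<one>"
      using endomorphism_from_cyclic[OF p b(1) ordb A _ d(1)] by blast
    have "(\<lambda>z. g z \<otimes> h z) \<in> hom G G" by (rule hom_group_mult[OF g(1) h(1)])
    moreover have "g b = \<one>" "h a = \<one>" using g(3) h(3) by (simp_all add: generate.incl)
    ultimately show ?thesis using g(2) h(2) c(1) d(1)
      by (intro bexI[of _ "\<lambda>z. g z \<otimes> h z"]) simp_all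
  qed
  then obtain g where g: "g \<in> hom G G" "g a = c" "g b = d" by blast
  have "g x = y"
    unfolding b(2) d(2) using g a(1) b(1) hom_nat_pow[OF g(1) a(1) group_axioms group_axioms]
    by (simp add: hom_mult[OF g(1)])
  then show ?thesis using g(1) by blast
qed

text \<open>
  A homomorphism from \<open>\<langle>x\<rangle>\<close> is determined by the image of \<open>x\<close>, whose order divides that of \<open>x\<close>.
\<close>

lemma Q_subgroup_if_endomorphisms:
  assumes x: "x \<in> carrier G"
    and ext: "\<And>y. y \<in> carrier G \<Longrightarrow> y [^] ord x = \<one> \<Longrightarrow> \<exists>g \<in> hom G G. g x = y"
  shows "generate G {x} \<in> Q_subgroups G"
proof -
  let ?N = "generate G {x}"
  have N: "subgroup ?N G" using x by (simp add: generate_is_subgroup)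
  have xN: "x \<in> ?N" by (simp add: generate.incl)
  note gN = subgroup_imp_group[OF N]
  have "\<exists>g \<in> hom G G. \<forall>z \<in> ?N. g z = f z" if f: "f \<in> hom (G\<lparr>carrier := ?N\<rparr>) G" for f
  proof -
    have pow: "f (x [^] r) = f x [^] r" for r :: int
      using hom_int_pow[OF f _ gN group_axioms, of x r] xN int_pow_consistent[OF N xN] by simp
    have fx: "f x \<in> carrier G" using f xN by (auto simp: hom_def)
    have "f x [^] ord x = f (x [^] int (ord x))"
      using pow[of "int (ord x)"] by (simp add: int_pow_int)
    also have "\<dots> = \<one>"
      using x pow[of 0] by (simp add: int_pow_int)
    finally obtain g where g: "g \<in> hom G G" "g x = f x" using ext fx by blast
    have "g z = f z" if "z \<in> ?N" for z
      using that pow g(2) hom_int_pow[OF g(1) x group_axioms group_axioms]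
      by (auto simp: generate_pow[OF x])
    then show ?thesis using g(1) by blast
  qed
  then show ?thesis using N by (simp add: Q_subgroups_def)
qed

lemma Q_subgroup_is_P_subgroup: "N \<in> Q_subgroups G \<Longrightarrow> N \<in> P_subgroups G"
  by (auto simp: Q_subgroups_def P_subgroups_def mon_def)

end

section \<open>Gaps of sequences of natural numbers\<close>

text \<open>
  For a sequence of finite heights these are the gaps of the Ulm sequence; the value \<open>0\<close> in the first
  case is the convention \<open>h\<^sub>-\<^sub>1 + 1 = 0\<close>.
\<close>

definition jumps_at :: "(nat \<Rightarrow> nat) \<Rightarrow> nat \<Rightarrow> bool" where
  "jumps_at H k \<longleftrightarrow> (case k of 0 \<Rightarrow> 0 | Suc j \<Rightarrow> Suc (H j)) < H k"

lemma ge_if_increasing: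
  fixes H :: "nat \<Rightarrow> nat"
  assumes inc: "\<And>j. Suc j < n \<Longrightarrow> H j < H (Suc j)"
    and "k \<le> i" "i < n"
  shows "H k + (i - k) \<le> H i"
  using assms(2,3)
proof (induction i rule: dec_induct)
  case (step i)
  then show ?case using inc[of i] by simp
qed simp

lemma eq_if_no_jumps:
  fixes H :: "nat \<Rightarrow> nat"
  assumes inc: "\<And>j. Suc j < n \<Longrightarrow> H j < H (Suc j)"
    and "k \<le> i" "i < n" and "\<And>j. k < j \<Longrightarrow> j \<le> i \<Longrightarrow> \<not> jumps_at H j"
  shows "H i = H k + (i - k)"
  using assms(2-4)
proof (induction i rule: dec_induct)
  case (step i)
  have "\<not> jumps_at H (Suc i)" using step.hyps step.prems by simp
  then have "H (Suc i) = Suc (H i)" using inc[of i] step.prems(1) by (simp add: jumps_at_def)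
  moreover have "H i = H k + (i - k)" using step by simp
  ultimately show ?case using step.hyps by simp
qed simp

lemma less_if_jumps_at:
  assumes inc: "\<And>j. Suc j < n \<Longrightarrow> H j < H (Suc j)" and k: "k < n" "jumps_at H k"
  shows "k < H k"
proof (cases k)
  case (Suc j)
  then show ?thesis using k ge_if_increasing[of n H 0 j] inc by (simp add: jumps_at_def)
qed (use k in \<open>simp add: jumps_at_def\<close>)

section \<open>Gaps of the height sequence and extension of homomorphisms\<close>

context comm_group
begin

lemma height_sequence_increasing:
  assumes x: "x \<in> carrier G" and H: "\<And>i. i < n \<Longrightarrow> has_finite_height p (x [^] (p ^ i)) (H i)"
    and j: "Suc j < n"
  shows "H j < H (Suc j)"
proof -
  have "x [^] (p ^ j) \<in> powers p (H j)" using H[of j] j by (simp add: has_finite_height_def)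
  then have "(x [^] (p ^ j)) [^] (p ^ 1) \<in> powers p (H j + 1)" by (rule powers_pow)
  then have "x [^] (p ^ Suc j) \<in> powers p (Suc (H j))"
    using x by (simp add: nat_pow_pow mult.commute)
  then show ?thesis using mem_powers_iff_le_height[OF H[OF j], of "Suc (H j)"] by simp
qed

text \<open>
  Of two gaps \<open>i < j\<close>, the first one lifts the height \<open>m\<close> of \<open>x [^] (p ^ (j - 1))\<close> to at least \<open>j\<close>.
  The second one produces a cyclic summand of exponent \<open>m + 1\<close>, and \<open>m + 1\<close> lies in the range
  of exponents that the gap before \<open>j\<close> excludes.
\<close>

lemma jumps_of_P_subgroup:
  assumes p: "Factorial_Ring.prime p" and P: "generate G {x} \<in> P_subgroups G"
    and x: "x \<in> carrier G" "ord x = p ^ n"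
    and H: "\<And>i. i < n \<Longrightarrow> has_finite_height p (x [^] (p ^ i)) (H i)"
    and k: "k < n" "jumps_at H k"
  shows "\<And>j. j < n \<Longrightarrow> jumps_at H j \<Longrightarrow> j = k"
    and "\<And>e l. H k = k + l \<Longrightarrow> Suc k \<le> e \<Longrightarrow> e < n + l \<Longrightarrow> \<not> has_cyclic_summand p G e"
proof -
  note inc = height_sequence_increasing[OF x(1) H]
  have no: "\<not> has_cyclic_summand p G e"
    if i: "i < n" "jumps_at H i" "H i = i + l" "Suc i \<le> e" "e < n + l" for i e l
  proof (rule no_cyclic_summand_of_P_subgroup[OF p P x i(1) _ _ i(4,5)])
    show "x [^] (p ^ i) \<in> powers p (i + l)" using H[OF i(1)] i(3) by (simp add: has_finite_height_def)
    show "l > 0" using less_if_jumps_at[of n H i] inc i by simp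
  qed
  then show "\<And>e l. H k = k + l \<Longrightarrow> Suc k \<le> e \<Longrightarrow> e < n + l \<Longrightarrow> \<not> has_cyclic_summand p G e"
    using k by blast
  have two: False if ij: "i < j" "j < n" "jumps_at H i" "jumps_at H j" for i j
  proof -
    obtain m where m: "j = Suc m" using ij(1) by (cases j) auto
    have "i < H i" by (rule less_if_jumps_at[of n]) (use inc ij in auto)
    moreover have "H i + (m - i) \<le> H m" by (rule ge_if_increasing[of n]) (use inc ij m in auto)
    ultimately have low: "j \<le> H m" using ij(1) m by simp
    have gap: "Suc (Suc (H m)) \<le> H j" using ij(4) m by (simp add: jumps_at_def)
    have "x [^] (p ^ j) \<in> powers p (Suc (Suc (H m)))"
      by (rule iffD2[OF mem_powers_iff_le_height[OF H[OF ij(2)]] gap])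
    then have "(x [^] (p ^ m)) [^] p \<in> powers p (Suc (Suc (H m)))"
      using x(1) m by (simp add: nat_pow_pow mult.commute)
    then have "has_cyclic_summand p G (Suc (H m))"
      using H[of m] ij(2) m unfolding has_finite_height_def by (intro cyclic_summand_of_gap[OF p]) auto
    then show False using no[OF ij(2,4), of "H j - j" "Suc (H m)"] low gap ij(2) by simp
  qed
  show "j = k" if "j < n" "jumps_at H j" for j
    using two[of j k] two[of k j] that k by (meson linorder_neqE_nat)
qed

text \<open>
  With at most one gap, the heights are \<open>i\<close> before it and \<open>i + l\<close> from it on, as required by
  \<open>endomorphism_of_pure_cyclic\<close> and \<open>endomorphism_of_one_gap\<close>.
\<close>

lemma endomorphism_if_at_most_one_jump:
  assumes p: "Factorial_Ring.prime p"
    and x: "x \<in> carrier G" "ord x = p ^ n"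
    and H: "\<And>i. i < n \<Longrightarrow> has_finite_height p (x [^] (p ^ i)) (H i)"
    and single: "\<And>j k. j < n \<Longrightarrow> jumps_at H j \<Longrightarrow> k < n \<Longrightarrow> jumps_at H k \<Longrightarrow> j = k"
    and no: "\<And>k l e. k < n \<Longrightarrow> jumps_at H k \<Longrightarrow> H k = k + l \<Longrightarrow> Suc k \<le> e \<Longrightarrow> e < n + l \<Longrightarrow>
      \<not> has_cyclic_summand p G e"
    and y: "y \<in> carrier G" "y [^] (p ^ n) = \<one>"
  shows "\<exists>g \<in> hom G G. g x = y"
proof (cases n)
  case 0
  then have "x = y" using x y ord_eq_1 by auto
  then show ?thesis by (intro bexI[of _ "\<lambda>z. z"]) (auto simp: hom_def)
next
  case (Suc m)
  note inc = height_sequence_increasing[OF x(1) H]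
  have initial: "H i = i" if i: "i < n" "\<And>j. j \<le> i \<Longrightarrow> \<not> jumps_at H j" for i
  proof -
    have "H i = H 0 + (i - 0)" by (rule eq_if_no_jumps[of n]) (use inc i in auto)
    moreover have "H 0 = 0" using i(2)[of 0] by (simp add: jumps_at_def)
    ultimately show ?thesis by simp
  qed
  show ?thesis
  proof (cases "\<exists>k<n. jumps_at H k")
    case False
    then have "H m = m" using initial[of m] Suc by simp
    then have "x [^] (p ^ m) \<notin> powers p (Suc m)" using H[of m] Suc by (simp add: has_finite_height_def)
    then show ?thesis using x(2) y unfolding Suc by (intro endomorphism_of_pure_cyclic[OF p x(1)])
  next
    case True
    then obtain k where k: "k < n" "jumps_at H k" by blast
    have kH: "k < H k" by (rule less_if_jumps_at[of n]) (use inc k in auto)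
    define l where "l = H k - k"
    have l: "l > 0" "H k = k + l" using kH by (simp_all add: l_def)
    have other: "\<not> jumps_at H j" if "j < n" "j \<noteq> k" for j using single k that by blast
    show ?thesis
    proof (rule endomorphism_of_one_gap[OF p x(1) _ _ _ l(1)])
      show "ord x = p ^ Suc m" "k \<le> m" "y \<in> carrier G" "y [^] (p ^ Suc m) = \<one>"
        using x(2) Suc k(1) y by simp_all
      show "x [^] (p ^ k) \<in> powers p (k + l)"
        using H[OF k(1)] l(2) by (simp add: has_finite_height_def)
      show "x [^] (p ^ j) \<notin> powers p k" if "k = Suc j" for j
      proof -
        have "H j = j" by (rule initial) (use k(1) that other in auto)
        then show ?thesis using H[of j] k(1) that by (simp add: has_finite_height_def)
      qed
      have "H m = H k + (m - k)"
        by (rule eq_if_no_jumps[of n]) (use inc k Suc other in auto)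
      then have "H m = m + l" using k(1) l(2) Suc by simp
      then show "x [^] (p ^ m) \<notin> powers p (Suc (m + l))"
        using H[of m] Suc by (simp add: has_finite_height_def)
      show "y [^] (p ^ k) \<in> powers p (k + l)"
        by (rule pow_mem_powers_of_no_summand[OF p y]) (use k l(2) no in auto)
    qed
  qed
qed

end

section \<open>Ulm sequences with finite heights\<close>

lemma ord_of_nat_less_iff: "ord_of_nat m < (ord_of_nat m' :: 'a ulm_ordinal) \<longleftrightarrow> m < m'"
proof -
  have "ord_of_nat n < (ord_of_nat (Suc n) :: 'a ulm_ordinal)" for n
    by (simp add: less_osucc)
  then show ?thesis by (rule lift_Suc_mono_less_iff)
qed

lemma ord_of_nat_eq_iff: "ord_of_nat m = (ord_of_nat m' :: 'a ulm_ordinal) \<longleftrightarrow> m = m'"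
  by (metis less_irrefl linorder_neqE_nat ord_of_nat_less_iff)

lemma gap_before_iff_jumps_at:
  fixes G :: "('a, 'b) monoid_scheme"
  assumes U: "\<And>i. i < n \<Longrightarrow> ulm_sequence p G x i = Fin (ord_of_nat (H i))" and k: "k < n"
  shows "gap_before (ulm_sequence p G x) k \<longleftrightarrow> jumps_at H k"
proof (cases k)
  case 0
  then show ?thesis
    using U[OF k] ord_of_nat_less_iff[of 0 "H 0"] by (simp add: gap_before_def jumps_at_def)
next
  case (Suc j)
  then show ?thesis
    using U[OF k] U[of j] k ord_of_nat_less_iff[of "Suc (H j)" "H k"]
    by (simp add: gap_before_def jumps_at_def)
qed

theorem theorem2p5:
  fixes G :: "('a, 'b) monoid_scheme" (structure) and p n :: nat and x :: 'a
  assumes "Factorial_Ring.prime p"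
    and "comm_group G" and "p_group p G"
    and "x \<in> carrier G" and "group.ord G x = p ^ n"
    and "generate G {x} \<inter> first_ulm_subgroup p G = {\<one>}"
  shows "(generate G {x} \<in> Q_subgroups G \<longleftrightarrow> generate G {x} \<in> P_subgroups G) \<and>
    (generate G {x} \<in> P_subgroups G \<longleftrightarrow>
      card {k. k < n \<and> gap_before (ulm_sequence p G x) k} \<le> 1 \<and>
      (\<forall>k l. k < n \<and> gap_before (ulm_sequence p G x) k \<and>
          height p G (x [^] (p ^ k)) = Fin (ord_of_nat (k + l)) \<longrightarrow>
        (\<forall>e. k + 1 \<le> e \<and> e \<le> n + l - 1 \<longrightarrow> \<not> has_cyclic_summand p G e)))"
proof -
  note p = assms(1) and x = assms(4,5)
  interpret comm_group G by (rule assms(2))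
  have "\<exists>m. has_finite_height p (x [^] (p ^ i)) m" if i: "i < n" for i
  proof -
    have "x [^] (p ^ i) \<noteq> \<one>"
      using i x prime_gt_1_nat[OF p] by (auto simp: pow_eq_id dest: power_dvd_imp_le)
    moreover have "x [^] (p ^ i) \<in> generate G {x}"
      using subgroup_pow_closed[OF generate_is_subgroup] x(1) generate.incl[of x "{x}" G] by simp
    ultimately obtain m where "x [^] (p ^ i) \<notin> powers p m"
      using assms(6) by (auto simp: first_ulm_subgroup_def)
    moreover have "x [^] (p ^ i) \<in> powers p 0" using x(1) by (simp add: multiples_def)
    ultimately show ?thesis using finite_height_exists by blast
  qed
  then obtain H where H: "\<And>i. i < n \<Longrightarrow> has_finite_height p (x [^] (p ^ i)) (H i)" by metis
  have h: "height p G (x [^] (p ^ i)) = Fin (ord_of_nat (H i))" if "i < n" for i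
    by (rule height_eq_ord_of_nat[OF p assms(3) H[OF that]])
  have gap: "gap_before (ulm_sequence p G x) k \<longleftrightarrow> jumps_at H k" if "k < n" for k
    by (rule gap_before_iff_jumps_at[OF _ that]) (simp add: ulm_sequence_def h)
  let ?one = "\<forall>j k. j < n \<and> jumps_at H j \<and> k < n \<and> jumps_at H k \<longrightarrow> j = k"
  let ?none = "\<forall>k l e. k < n \<and> jumps_at H k \<and> H k = k + l \<and> Suc k \<le> e \<and> e < n + l \<longrightarrow>
    \<not> has_cyclic_summand p G e"
  have "{k. k < n \<and> gap_before (ulm_sequence p G x) k} = {k. k < n \<and> jumps_at H k}"
    using gap by blast
  then have card: "card {k. k < n \<and> gap_before (ulm_sequence p G x) k} \<le> 1 \<longleftrightarrow> ?one"
    by (auto simp: card_le_Suc0_iff_eq)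
  have none: "(\<forall>k l. k < n \<and> gap_before (ulm_sequence p G x) k \<and>
          height p G (x [^] (p ^ k)) = Fin (ord_of_nat (k + l)) \<longrightarrow>
        (\<forall>e. k + 1 \<le> e \<and> e \<le> n + l - 1 \<longrightarrow> \<not> has_cyclic_summand p G e)) \<longleftrightarrow> ?none"
  proof -
    have "k < n \<and> gap_before (ulm_sequence p G x) k \<and>
          height p G (x [^] (p ^ k)) = Fin (ord_of_nat (k + l)) \<longleftrightarrow>
        k < n \<and> jumps_at H k \<and> H k = k + l" for k l
      using gap h by (auto simp: ord_of_nat_eq_iff)
    moreover have "e \<le> n + l - 1 \<longleftrightarrow> e < n + l" if "k < n" for e l k
      using that by auto
    ultimately show ?thesis by (metis Suc_eq_plus1)
  qed
  have PQ: "generate G {x} \<in> Q_subgroups G" if "?one" "?none"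
  proof (rule Q_subgroup_if_endomorphisms[OF x(1)])
    fix y assume "y \<in> carrier G" "y [^] ord x = \<one>"
    then show "\<exists>g \<in> hom G G. g x = y"
      using that x(2) by (intro endomorphism_if_at_most_one_jump[OF p x H]) auto
  qed
  have "?one \<and> ?none" if "generate G {x} \<in> P_subgroups G"
    using jumps_of_P_subgroup[OF p that x H] by blast
  then show ?thesis
    unfolding card none using PQ Q_subgroup_is_P_subgroup by blast
qed

end
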